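(* Let $n$ be a nonnegative integer. The set $\mathcal U_{12n+4}$ is nonempty if and only if $\nu_p(3n+1)$ is even for all $p\in\Pi_2$. In this case, set $$q_n=\prod_{p\in\Pi_2}p^{\frac12\nu_p(3n+1)}\quad\text{and}\quad y_{\underline j}=x_{\underline j}\,q_n\quad\text{for }\underline j\in\mathcal V_n.$$ Then, for any $\underline j\in\mathcal V_n$, there are integers $u_{\underline j}$ and $v_{\underline j}$ with residue $1$ modulo $3$ such that $$y_{\underline j}=\frac12\left(u_{\underline j}+v_{\underline j}\,i\sqrt3\right),$$ and $$\mathcal C_n=\{\vartheta^{-1}(u_{\underline j},v_{\underline j})\mid \underline j\in\mathcal V_n\}.$$
   Context: For a nonnegative integer $k$, $\mathcal U_k=\{(x,y)\in\mathbb Z^2\mid x^2+3y^2=k\}$. $\mathcal R=\mathbb Z[\mathbf j]$ with $\mathbf j=e^{2i\pi/3}$ is the ring of Eisenstein integers, and $\mathcal N(z)=z\overline z$ is its norm, where $\overline z$ is the complex conjugate of $z$. $\Pi_1$ and $\Pi_2$ are the sets of prime numbers congruent to $1$, respectively $2$, modulo $3$; $\nu_p$ is the $p$-adic valuation. For each $p\in\Pi_1$, $x_p\in\mathcal R$ is an irreducible element with $\mathcal N(x_p)=p$ (such an element exists). Put $$\mathcal V_n=\prod_{p\in\Pi_1}\{0\le j_p\le\nu_p(3n+1)\},$$ the set of families $\underline j=(j_p\mid p\in\Pi_1)$ of integers with $0\le j_p\le\nu_p(3n+1)$, and for $\underline j\in\mathcal V_n$ $$x_{\underline j}=\prod_{p\in\Pi_1}x_p^{j_p}\,\overline{x_p}^{\,\nu_p(3n+1)-j_p}.$$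 A $3$-core partition is an integer partition whose Young diagram has no hook of length $3$ (the hook of a box $b$ consists of $b$, the boxes to its right in its row and the boxes below it in its column; its hooklength is its number of boxes). The size of a partition is the sum of its parts. Characteristic vector of a $3$-core $\lambda$: for each diagonal box $d$ of the Young diagram, the arm at $d$ is the number of boxes in the same row strictly to the right of $d$, and the leg at $d$ is the number of boxes in the same column strictly below $d$. Let $\mathcal A_\lambda$ and $\mathcal L_\lambda$ be the sets of arms and of legs. For $i\in\{0,1,2\}$, if no element of $\mathcal L_\lambda$ is congruent to $2-i$ modulo $3$, set $c_i=|\{a\in\mathcal A_\lambda\mid a\equiv i \bmod 3\}|$; otherwise set $c_i=-|\{l\in\mathcal L_\lambda\mid l\equiv 2-i\bmod 3\}|$. The characteristic vector of $\lambda$ is $(c_0,c_1,c_2)$; it satisfies $c_0+c_1+c_2=0$ and is identified with the pair $(x,y)=(c_1,c_2)\in\mathbb Z^2$ (so $(c_0,c_1,c_2)=(-x-y,x,y)$). The map sending a $3$-core to its characteristic vector is a bijection from the set of all $3$-cores onto $\{(c_0,c_1,c_2)\in\mathbb Z^3\mid c_0+c_1+c_2=0\}$. $\mathcal C_n\subseteq\mathbb Z^2$ denotes the set of characteristic vectors $(x,y)$ of the $3$-core partitions of size $n$. $\vartheta:\mathcal C_n\to\mathcal U_{12n+4}$ is the injective map $(x,y)\mapsto(6x+3y+1,3y+1)$.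
   Formalization: The equation y_j = (u_j + v_j i√3)/2 with u_j, v_j of residue 1 mod 3 is required only up to a unit of the Eisenstein integers (some unit times y_j), since as printed it fails, e.g. for n = 0, where y_j = 1 gives (u,v) = (2,0). *)

theory Defs
  imports
    Complex_Main
    "HOL-Library.FuncSet"
    "HOL-Algebra.Ring_Divisibility"
    "HOL-Computational_Algebra.Primes"
begin

hide_const (open) Divisibility.prime

section \<open>Partitions, 3-cores and their characteristic vectors\<close>

definition is_partition :: "nat list \<Rightarrow> bool" where
  "is_partition lam \<longleftrightarrow> sorted_wrt (\<ge>) lam \<and> (\<forall>m \<in> set lam. m > 0)"

text \<open>Boxes are pairs (row, column), both counted from 0.\<close>

definition young_diagram :: "nat list \<Rightarrow> (nat \<times> nat) set" where
  "young_diagram lam = {(r, c). r < length lam \<and> c < lam ! r}"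

definition arm_boxes :: "nat list \<Rightarrow> nat \<times> nat \<Rightarrow> (nat \<times> nat) set" where
  "arm_boxes lam b = {d \<in> young_diagram lam. fst d = fst b \<and> snd d > snd b}"

definition leg_boxes :: "nat list \<Rightarrow> nat \<times> nat \<Rightarrow> (nat \<times> nat) set" where
  "leg_boxes lam b = {d \<in> young_diagram lam. snd d = snd b \<and> fst d > fst b}"

definition hook_length :: "nat list \<Rightarrow> nat \<times> nat \<Rightarrow> nat" where
  "hook_length lam b = card ({b} \<union> arm_boxes lam b \<union> leg_boxes lam b)"

definition is_3core :: "nat list \<Rightarrow> bool" where
  "is_3core lam \<longleftrightarrow> is_partition lam \<and> (\<forall>b \<in> young_diagram lam. hook_length lam b \<noteq> 3)"

definition arms :: "nat list \<Rightarrow> nat set" where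
  "arms lam = {card (arm_boxes lam (d, d)) | d. (d, d) \<in> young_diagram lam}"

definition legs :: "nat list \<Rightarrow> nat set" where
  "legs lam = {card (leg_boxes lam (d, d)) | d. (d, d) \<in> young_diagram lam}"

text \<open>Only meant for \<open>i \<le> 2\<close>, where the truncated subtraction \<open>2 - i\<close> is the true one.\<close>

definition char_coeff :: "nat list \<Rightarrow> nat \<Rightarrow> int" where
  "char_coeff lam i =
     (if \<forall>l \<in> legs lam. l mod 3 \<noteq> 2 - i
      then int (card {a \<in> arms lam. a mod 3 = i})
      else - int (card {l \<in> legs lam. l mod 3 = 2 - i}))"

text \<open>The vector \<open>(c\<^sub>0, c\<^sub>1, c\<^sub>2)\<close> has sum 0 and is recorded by its last two entries.\<close>

definition char_vec :: "nat list \<Rightarrow> int \<times> int" where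
  "char_vec lam = (char_coeff lam 1, char_coeff lam 2)"

definition core_vecs :: "nat \<Rightarrow> (int \<times> int) set" where
  "core_vecs n = {char_vec lam | lam. is_3core lam \<and> sum_list lam = n}"

definition solutions :: "nat \<Rightarrow> (int \<times> int) set" where
  "solutions k = {(x, y). x\<^sup>2 + 3 * y\<^sup>2 = int k}"

definition theta :: "int \<times> int \<Rightarrow> int \<times> int" where
  "theta = (\<lambda>(x, y). (6 * x + 3 * y + 1, 3 * y + 1))"

section \<open>Eisenstein integers\<close>

definition eis_j :: complex where
  "eis_j = exp (2 * \<i> * of_real pi / 3)"

definition eisenstein :: "complex ring" where
  "eisenstein =
     \<lparr>carrier = {of_int a + of_int b * eis_j | a b :: int. True},
      mult = (*), one = 1, zero = 0, add = (+)\<rparr>"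

definition eis_norm :: "complex \<Rightarrow> complex" where
  "eis_norm z = z * cnj z"

definition primes1 :: "nat set" where
  "primes1 = {p. prime p \<and> p mod 3 = 1}"

definition primes2 :: "nat set" where
  "primes2 = {p. prime p \<and> p mod 3 = 2}"

definition families :: "nat \<Rightarrow> (nat \<Rightarrow> nat) set" where
  "families n = (\<Pi>\<^sub>E p\<in>primes1. {0..multiplicity p (3 * n + 1)})"

text \<open>
  Products over all primes in a residue class are restricted to the prime divisors of
  \<open>3 * n + 1\<close>: the other factors are 1, but \<^const>\<open>prod\<close> over an infinite set is 1 by convention.
\<close>

definition x_fam :: "(nat \<Rightarrow> complex) \<Rightarrow> nat \<Rightarrow> (nat \<Rightarrow> nat) \<Rightarrow> complex" where
  "x_fam x n j =
     (\<Prod>p \<in> {p \<in> primes1. p dvd 3 * n + 1}.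
        x p ^ j p * cnj (x p) ^ (multiplicity p (3 * n + 1) - j p))"

definition q_of :: "nat \<Rightarrow> nat" where
  "q_of n = (\<Prod>p \<in> {p \<in> primes2. p dvd 3 * n + 1}. p ^ (multiplicity p (3 * n + 1) div 2))"

definition y_fam :: "(nat \<Rightarrow> complex) \<Rightarrow> nat \<Rightarrow> (nat \<Rightarrow> nat) \<Rightarrow> complex" where
  "y_fam x n j = x_fam x n j * of_nat (q_of n)"

text \<open>
  The equality \<open>y = (u + v \<i> \<surd>3) / 2\<close> with \<open>u\<close> and \<open>v\<close> both of residue 1 modulo 3 has to be read
  up to a unit of the Eisenstein integers: for \<open>n = 0\<close> the only \<open>y\<close> is \<open>1 = (2 + 0 \<i> \<surd>3) / 2\<close>,
  whereas \<open>(1 + 1 \<i> \<surd>3) / 2\<close> is the associate with the required residues.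
\<close>

definition normalized_coords :: "complex \<Rightarrow> int \<Rightarrow> int \<Rightarrow> bool" where
  "normalized_coords y u v \<longleftrightarrow>
     u mod 3 = 1 \<and> v mod 3 = 1 \<and>
     (\<exists>\<epsilon> \<in> Units eisenstein. \<epsilon> * y = (of_int u + of_int v * \<i> * of_real (sqrt 3)) / 2)"

end

theory Submission
  imports Defs "HOL-Number_Theory.Residue_Primitive_Roots"
begin

text \<open>
  The proof compares two descriptions of the solutions \<open>(u, v)\<close> of \<open>u\<^sup>2 + 3 v\<^sup>2 = 12 n + 4\<close> with
  \<open>u \<equiv> v \<equiv> 1\<close> modulo 3.

  On the side of partitions, a partition with parts \<open>p\<^sub>0 \<ge> p\<^sub>1 \<ge> ...\<close>, continued by zeros, is encoded by
  its beads \<open>p\<^sub>i - i - 1\<close>. Hook lengths are the differences between a bead and a smaller non-bead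
  (\<open>hook_length_eq\<close>), so a partition is a 3-core if and only if its set of beads is closed under
  subtracting 3. Then each residue class \<open>i\<close> modulo 3 contains the beads \<open>3 t + i\<close> with \<open>t < c\<^sub>i\<close>, and
  \<open>(c\<^sub>0, c\<^sub>1, c\<^sub>2)\<close> is the characteristic vector (\<open>char_coeff_eq\<close>). Summing the beads gives
  \<open>n = 3 (x\<^sup>2 + x y + y\<^sup>2) + x + 2 y\<close> for the size \<open>n\<close> of the 3-core with vector \<open>(x, y)\<close>, and every integer
  pair occurs (\<open>core_vecs_eq\<close>). Completing the square by \<^const>\<open>theta\<close>, one finds that \<^const>\<open>theta\<close> maps
  \<^term>\<open>core_vecs n\<close> onto the set of all these solutions (\<open>theta_image_core_vecs\<close>).

  On the side of numbers, \<open>(u + v \<i> sqrt 3) / 2\<close> is an Eisenstein integer of norm \<open>3 n + 1\<close>. A prime \<open>p \<equiv> 2\<close>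
  modulo 3 divides every element whose norm it divides (\<open>inert_prime_dvd\<close>), so it occurs in norms with
  even exponent only. For \<open>p \<equiv> 1\<close>, an element \<open>x\<close> of norm \<open>p\<close> exists by Thue's pigeonhole argument
  (\<open>primes1_norm\<close>), and \<open>x\<close> or \<open>cnj x\<close> divides every element whose norm \<open>p\<close> divides (\<open>norm_prime_dvd\<close>).
  Stripping off one prime after the other shows that the elements of norm \<open>3 n + 1\<close> are up to units the
  products \<^const>\<open>y_fam\<close> (\<open>eis_associate_y_fam\<close>); this also decides when there are any.

  The two sides fit together because exactly one of the six associates of an element of norm \<open>3 n + 1\<close>
  has both coordinates congruent to 1 modulo 3 (\<open>normalized_coords_exist\<close>, \<open>normalized_coords_unique\<close>).
\<close>

section \<open>Beads and gaps of a partition\<close>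

definition part :: "nat list \<Rightarrow> nat \<Rightarrow> nat" where
  "part lam i = (if i < length lam then lam ! i else 0)"

text \<open>
  For a partition the parts decrease, so this is the number of parts larger than \<open>c\<close>, that is the
  height of column \<open>c\<close>. The minimum is convenient because it turns the comparison of a row
  with a column into a comparison of a row with a part.
\<close>

definition col :: "nat list \<Rightarrow> nat \<Rightarrow> nat" where
  "col lam c = (LEAST i. part lam i \<le> c)"

text \<open>
  The beads are the positions of the Maya diagram (or abacus) of the partition: for the
  empty partition they fill the negative integers. Row \<open>r\<close> gives a bead, column \<open>c\<close> gives a gap, and
  walking along the rim of the Young diagram one meets a vertical step for each bead and a horizontal
  step for each gap.
\<close>

definition bead :: "nat list \<Rightarrow> nat \<Rightarrow> int" where
  "bead lam i = int (part lam i) - int i - 1"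

definition gap :: "nat list \<Rightarrow> nat \<Rightarrow> int" where
  "gap lam c = int c - int (col lam c)"

lemma young_diagram_iff: "(r, c) \<in> young_diagram lam \<longleftrightarrow> c < part lam r"
  by (auto simp: young_diagram_def part_def)

lemma part_antimono:
  assumes "is_partition lam" "i \<le> j"
  shows "part lam j \<le> part lam i"
  using assms by (cases "i = j") (auto simp: part_def is_partition_def sorted_wrt_iff_nth_less)

lemma less_col_iff:
  assumes "is_partition lam"
  shows "i < col lam c \<longleftrightarrow> c < part lam i"
proof -
  have "part lam (length lam) \<le> c"
    by (simp add: part_def)
  then have *: "part lam (col lam c) \<le> c"
    unfolding col_def by (rule LeastI)
  show ?thesis
  proof
    show "c < part lam i" if "i < col lam c"
      using not_less_Least[of i "\<lambda>i. part lam i \<le> c"] that by (simp add: col_def)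
    show "i < col lam c" if "c < part lam i"
      using part_antimono[OF assms, of "col lam c" i] * that by (cases "i < col lam c") auto
  qed
qed

lemma gap_less_bead_iff:
  assumes "is_partition lam"
  shows "gap lam c < bead lam r \<longleftrightarrow> c < part lam r"
  using less_col_iff[OF assms, of r c] by (auto simp: gap_def bead_def)

lemma bead_neq_gap:
  assumes "is_partition lam"
  shows "bead lam r \<noteq> gap lam c"
  using less_col_iff[OF assms, of r c] by (auto simp: gap_def bead_def)

lemma bead_strict_antimono:
  assumes "is_partition lam" "i < j"
  shows "bead lam j < bead lam i"
  using part_antimono[OF assms(1), of i j] assms(2) by (simp add: bead_def)

lemma inj_bead: "is_partition lam \<Longrightarrow> inj (bead lam)"
  by (rule injI) (metis bead_strict_antimono less_irrefl linorder_neqE_nat)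

text \<open>
  The rim passes each integer exactly once, in a vertical or in a horizontal step.
\<close>

lemma range_gap:
  assumes "is_partition lam"
  shows "range (gap lam) = - range (bead lam)"
proof (intro equalityI subsetI)
  fix g assume "g \<in> - range (bead lam)"
  then have g: "g \<noteq> bead lam i" for i by auto
  define i where "i = (LEAST i. bead lam i < g)"
  have "bead lam (length lam + nat (- g)) < g"
    by (simp add: bead_def part_def)
  then have less: "bead lam i < g"
    unfolding i_def by (rule LeastI)
  have greater: "g < bead lam j" if "j < i" for j
    using not_less_Least[of j "\<lambda>i. bead lam i < g"] that g[of j] by (auto simp: i_def)
  \<comment> \<open>\<open>i\<close> beads lie above \<open>g\<close>; if column \<open>c\<close> has height \<open>i\<close>, then its gap is \<open>c - i\<close>, which forces \<open>c\<close>.\<close>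
  define c where "c = nat (g + int i)"
  have c: "int c = g + int i"
    using less by (simp add: c_def bead_def)
  have "\<not> i < col lam c"
    using less c by (simp add: less_col_iff[OF assms] bead_def)
  moreover have "j < col lam c" if "j < i" "Suc j = i" for j
    using greater[of j] c that by (auto simp: less_col_iff[OF assms] bead_def)
  ultimately have "col lam c = i"
    by (cases i) (auto simp: not_less_eq)
  then show "g \<in> range (gap lam)"
    using c by (auto simp: gap_def intro!: image_eqI[of _ _ c])
qed (auto simp: bead_neq_gap[OF assms, symmetric])

lemma card_arm_boxes:
  "c < part lam r \<Longrightarrow> int (card (arm_boxes lam (r, c))) = int (part lam r) - int c - 1"
proof -
  assume *: "c < part lam r"
  have "arm_boxes lam (r, c) = Pair r ` {c<..<part lam r}"
    by (auto simp: arm_boxes_def young_diagram_iff)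
  then show ?thesis
    using * by (simp add: card_image inj_on_def of_nat_diff)
qed

lemma card_leg_boxes:
  assumes "is_partition lam" "c < part lam r"
  shows "int (card (leg_boxes lam (r, c))) = int (col lam c) - int r - 1"
proof -
  have "leg_boxes lam (r, c) = (\<lambda>i. (i, c)) ` {r<..<col lam c}"
    by (auto simp: leg_boxes_def young_diagram_iff less_col_iff[OF assms(1)])
  moreover have "r < col lam c"
    using assms by (simp add: less_col_iff)
  ultimately show ?thesis
    by (simp add: card_image inj_on_def of_nat_diff)
qed

lemma finite_arm_leg_boxes: "finite (arm_boxes lam b)" "finite (leg_boxes lam b)"
proof -
  have "young_diagram lam \<subseteq> (SIGMA r:{..<length lam}. {..<lam ! r})"
    by (auto simp: young_diagram_def)
  then have "finite (young_diagram lam)"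
    by (rule finite_subset) auto
  then show "finite (arm_boxes lam b)" "finite (leg_boxes lam b)"
    by (auto simp: arm_boxes_def leg_boxes_def intro: finite_subset[rotated])
qed

text \<open>
  A hook runs from a horizontal to a vertical step of the rim, and its length is the distance
  between them.
\<close>

lemma hook_length_eq:
  assumes "is_partition lam" "c < part lam r"
  shows "int (hook_length lam (r, c)) = bead lam r - gap lam c"
proof -
  have "hook_length lam (r, c) = card (insert (r, c) (arm_boxes lam (r, c) \<union> leg_boxes lam (r, c)))"
    by (simp add: hook_length_def)
  also have "\<dots> = 1 + card (arm_boxes lam (r, c) \<union> leg_boxes lam (r, c))"
    by (subst card_insert_disjoint) (simp_all add: finite_arm_leg_boxes, auto simp: arm_boxes_def leg_boxes_def)
  also have "card (arm_boxes lam (r, c) \<union> leg_boxes lam (r, c)) =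
      card (arm_boxes lam (r, c)) + card (leg_boxes lam (r, c))"
    by (subst card_Un_disjoint) (simp_all add: finite_arm_leg_boxes, auto simp: arm_boxes_def leg_boxes_def)
  finally show ?thesis
    using card_arm_boxes[OF assms(2)] card_leg_boxes[OF assms] by (simp add: bead_def gap_def)
qed

text \<open>
  A hook of length 3 is a bead with a gap three places below it.
\<close>

lemma is_3core_iff:
  assumes "is_partition lam"
  shows "is_3core lam \<longleftrightarrow> (\<forall>m \<in> range (bead lam). m - 3 \<in> range (bead lam))"
proof
  assume core: "is_3core lam"
  show "\<forall>m \<in> range (bead lam). m - 3 \<in> range (bead lam)"
  proof (intro ballI, rule ccontr)
    fix m assume "m \<in> range (bead lam)" "m - 3 \<notin> range (bead lam)"
    then obtain r c where rc: "m = bead lam r" "m - 3 = gap lam c"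
      using range_gap[OF assms] by (metis ComplI imageE)
    then have "c < part lam r"
      using gap_less_bead_iff[OF assms, of c r] by simp
    moreover from hook_length_eq[OF assms this] rc have "hook_length lam (r, c) = 3"
      by simp
    ultimately show False
      using core by (auto simp: is_3core_def young_diagram_iff)
  qed
next
  assume closed: "\<forall>m \<in> range (bead lam). m - 3 \<in> range (bead lam)"
  have "hook_length lam (r, c) \<noteq> 3" if "c < part lam r" for r c
  proof
    assume "hook_length lam (r, c) = 3"
    then have "gap lam c = bead lam r - 3"
      using hook_length_eq[OF assms that] by simp
    with closed bead_neq_gap[OF assms] show False
      by (metis imageE rangeI)
  qed
  then show "is_3core lam"
    using assms by (auto simp: is_3core_def young_diagram_iff)
qed

text \<open>
  The diagonal boxes belong to the rows with a nonnegative bead, and the bead is then the arm. In the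
  same way the legs are the negative gaps, reflected by \<open>g \<mapsto> - 1 - g\<close>.
\<close>

lemma arms_iff:
  assumes "is_partition lam"
  shows "a \<in> arms lam \<longleftrightarrow> int a \<in> range (bead lam)"
proof -
  have "a \<in> arms lam \<longleftrightarrow> (\<exists>d. d < part lam d \<and> int a = bead lam d)"
    unfolding arms_def young_diagram_iff mem_Collect_eq
    by (intro ex_cong1) (auto simp: bead_def dest: card_arm_boxes)
  also have "\<dots> \<longleftrightarrow> int a \<in> range (bead lam)"
  proof safe
    fix d assume "int a = bead lam d"
    then show "\<exists>d. d < part lam d \<and> int a = bead lam d"
      by (intro exI[of _ d]) (simp add: bead_def)
  qed simp
  finally show ?thesis .
qed

lemma legs_iff:
  assumes "is_partition lam"
  shows "l \<in> legs lam \<longleftrightarrow> - 1 - int l \<notin> range (bead lam)"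
proof -
  have "l \<in> legs lam \<longleftrightarrow> (\<exists>d. d < part lam d \<and> - 1 - int l = gap lam d)"
    unfolding legs_def young_diagram_iff mem_Collect_eq
    by (intro ex_cong1) (auto simp: gap_def dest: card_leg_boxes[OF assms])
  also have "\<dots> \<longleftrightarrow> - 1 - int l \<in> range (gap lam)"
  proof safe
    fix d assume "- 1 - int l = gap lam d"
    then show "\<exists>d. d < part lam d \<and> - 1 - int l = gap lam d"
      by (intro exI[of _ d]) (simp add: gap_def less_col_iff[OF assms, symmetric])
  qed simp
  finally show ?thesis
    by (simp add: range_gap[OF assms])
qed

section \<open>Three runners and the characteristic vector\<close>

text \<open>
  The set \<open>M\<close> of beads is split by residues modulo 3 into three runners; on runner \<open>i\<close> the beads fill
  exactly the places \<open>3 * t + i\<close> with \<open>t < c i\<close>.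
\<close>

definition on_runners :: "int set \<Rightarrow> (nat \<Rightarrow> int) \<Rightarrow> bool" where
  "on_runners M c \<longleftrightarrow> (\<forall>m. m \<in> M \<longleftrightarrow> m div 3 < c (nat (m mod 3)))"

lemma on_runners_iff: "on_runners M c \<Longrightarrow> m \<in> M \<longleftrightarrow> m div 3 < c (nat (m mod 3))"
  by (simp add: on_runners_def)

text \<open>
  If beads can always be moved down by 3, each runner is filled without holes; the bounds
  \<open>a\<close> and \<open>b\<close> keep its level finite.
\<close>

lemma on_runnersE:
  fixes M :: "int set"
  assumes closed: "\<And>m. m \<in> M \<Longrightarrow> m - 3 \<in> M"
    and above: "\<And>m. m \<ge> b \<Longrightarrow> m \<notin> M"
    and below: "\<And>m. m < a \<Longrightarrow> m \<in> M"
  obtains c where "on_runners M c"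
proof -
  have "\<exists>e. \<forall>t. 3 * t + int i \<in> M \<longleftrightarrow> t < e" for i
  proof -
    have down: "3 * s + int i \<in> M" if "3 * t + int i \<in> M" "s \<le> t" for s t
      using that(2,1) by (induction s rule: int_le_induct) (auto dest: closed simp: algebra_simps)
    \<comment> \<open>Small enough that \<open>3 * t0 + i < a\<close> and \<open>t0 \<le> \<bar>b\<bar>\<close>.\<close>
    define t0 where "t0 = - \<bar>a\<bar> - int i - 1"
    have t0: "3 * t0 + int i \<in> M"
      by (rule below) (simp add: t0_def)
    define P where "P k \<longleftrightarrow> 3 * (t0 + int k) + int i \<notin> M" for k
    define k where "k = (LEAST k. P k)"
    have "t0 \<le> \<bar>b\<bar>"
      by (simp add: t0_def)
    then have "P (nat (\<bar>b\<bar> - t0))"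
      unfolding P_def by (intro above) simp
    then have k: "P k"
      unfolding k_def by (rule LeastI)
    have "3 * t + int i \<in> M \<longleftrightarrow> t < t0 + int k" for t
    proof
      assume "3 * t + int i \<in> M"
      then show "t < t0 + int k"
        using down k unfolding P_def by (metis not_le)
    next
      assume t: "t < t0 + int k"
      show "3 * t + int i \<in> M"
      proof (cases "t \<le> t0")
        case False
        with t have "nat (t - t0) < k" "t0 + int (nat (t - t0)) = t" by auto
        then show ?thesis
          using not_less_Least[of "nat (t - t0)" P] by (simp add: k_def P_def)
      qed (use down t0 in blast)
    qed
    then show ?thesis by blast
  qed
  then obtain c where c: "3 * t + int i \<in> M \<longleftrightarrow> t < c i" for i t
    by metis
  have "on_runners M c"
    unfolding on_runners_def
  proof
    fix m :: int
    show "m \<in> M \<longleftrightarrow> m div 3 < c (nat (m mod 3))"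
      using c[of "m div 3" "nat (m mod 3)"] by simp
  qed
  then show ?thesis by (rule that)
qed

lemma range_bead_on_runnersE:
  assumes "is_3core lam"
  obtains c where "on_runners (range (bead lam)) c"
proof -
  have part: "is_partition lam"
    using assms by (simp add: is_3core_def)
  show ?thesis
  proof (rule on_runnersE)
    show "m - 3 \<in> range (bead lam)" if "m \<in> range (bead lam)" for m
      using that assms is_3core_iff[OF part] by blast
    show "m \<notin> range (bead lam)" if "m \<ge> int (part lam 0)" for m
    proof
      assume "m \<in> range (bead lam)"
      then obtain i where "m = bead lam i" by auto
      with that part_antimono[OF part, of 0 i] show False by (simp add: bead_def)
    qed
    show "m \<in> range (bead lam)" if "m < - int (length lam)" for m
      using that by (intro image_eqI[of _ _ "nat (- m - 1)"]) (auto simp: bead_def part_def)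
  qed (rule that)
qed

text \<open>
  The place on runner \<open>i\<close> that corresponds to a leg \<open>l \<equiv> 2 - i\<close> under the reflection \<open>g \<mapsto> - 1 - g\<close>.
\<close>

lemma reflect_runner:
  assumes "l = 3 * s + (2 - i)" "i \<le> 2"
  shows "(- 1 - int l) div 3 = - int s - 1" "(- 1 - int l) mod 3 = int i"
proof -
  have *: "- 1 - int l = int i + 3 * (- int s - 1)"
    using assms by simp
  have **: "int i div 3 = 0" "int i mod 3 = int i"
    using assms(2) by auto
  show "(- 1 - int l) div 3 = - int s - 1" "(- 1 - int l) mod 3 = int i"
    unfolding * by (subst div_mult_self2 mod_mult_self2; simp add: **)+
qed

text \<open>
  If \<open>c i \<ge> 0\<close> then runner \<open>i\<close> has \<open>c i\<close> nonnegative beads, which are the arms congruent to \<open>i\<close>, and no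
  negative gap. If \<open>c i < 0\<close> then it has \<open>- c i\<close> negative gaps, and \<open>g \<equiv> i\<close> means that the leg
  \<open>- 1 - g\<close> is congruent to \<open>2 - i\<close>. The two cases of \<^const>\<open>char_coeff\<close> are these two signs.
\<close>

lemma char_coeff_eq:
  assumes part: "is_partition lam" and run: "on_runners (range (bead lam)) c" and i: "i \<le> 2"
  shows "char_coeff lam i = c i"
proof -
  have A: "{a \<in> arms lam. a mod 3 = i} = (\<lambda>s. 3 * s + i) ` {..<nat (c i)}"
  proof (intro equalityI subsetI)
    fix a assume "a \<in> {a \<in> arms lam. a mod 3 = i}"
    then have "int a div 3 < c i" "a mod 3 = i"
      using on_runners_iff[OF run, of "int a"] by (auto simp: arms_iff[OF part] nat_mod_as_int)
    then show "a \<in> (\<lambda>s. 3 * s + i) ` {..<nat (c i)}"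
      by (intro image_eqI[of _ _ "a div 3"]) auto
  next
    fix a assume "a \<in> (\<lambda>s. 3 * s + i) ` {..<nat (c i)}"
    then obtain s where s: "a = 3 * s + i" "int s < c i" by auto
    then have "int a div 3 = int s" "nat (int a mod 3) = i" "a mod 3 = i"
      using i by auto
    then show "a \<in> {a \<in> arms lam. a mod 3 = i}"
      using on_runners_iff[OF run, of "int a"] s by (auto simp: arms_iff[OF part])
  qed
  have L: "{l \<in> legs lam. l mod 3 = 2 - i} = (\<lambda>s. 3 * s + (2 - i)) ` {..<nat (- c i)}"
  proof (intro equalityI subsetI)
    fix l assume "l \<in> {l \<in> legs lam. l mod 3 = 2 - i}"
    then have l: "l \<in> legs lam" "l mod 3 = 2 - i" by auto
    then have "l = 3 * (l div 3) + (2 - i)"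
      by (metis mult_div_mod_eq)
    from reflect_runner[OF this i]
    have "(- 1 - int l) div 3 = - int (l div 3) - 1" "(- 1 - int l) mod 3 = int i" .
    then have "int (l div 3) < - c i"
      using on_runners_iff[OF run, of "- 1 - int l"] l by (auto simp: legs_iff[OF part])
    with l show "l \<in> (\<lambda>s. 3 * s + (2 - i)) ` {..<nat (- c i)}"
      by (intro image_eqI[of _ _ "l div 3"]) (auto simp flip: l(2))
  next
    fix l assume "l \<in> (\<lambda>s. 3 * s + (2 - i)) ` {..<nat (- c i)}"
    then obtain s where s: "l = 3 * s + (2 - i)" "int s < - c i" by auto
    note reflect_runner[OF s(1) i]
    moreover have "l mod 3 = 2 - i"
      by (simp add: s(1))
    ultimately show "l \<in> {l \<in> legs lam. l mod 3 = 2 - i}"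
      using s(2) by (simp add: legs_iff[OF part] on_runners_iff[OF run])
  qed
  have card: "card {a \<in> arms lam. a mod 3 = i} = nat (c i)"
    "card {l \<in> legs lam. l mod 3 = 2 - i} = nat (- c i)"
    unfolding A L by (simp_all add: card_image inj_on_def)
  have "(\<forall>l \<in> legs lam. l mod 3 \<noteq> 2 - i) \<longleftrightarrow> {l \<in> legs lam. l mod 3 = 2 - i} = {}"
    by auto
  also have "\<dots> \<longleftrightarrow> c i \<ge> 0"
    unfolding L image_is_empty lessThan_empty_iff bot_nat_def by simp
  finally show ?thesis
    by (simp add: char_coeff_def card)
qed

text \<open>
  Both the balance of the levels and the size of a 3-core come from summing over the beads above a
  cutoff. A cutoff at a multiple of 3 cuts all three runners at the same height.
\<close>

lemma sum_on_runners:
  assumes "on_runners M c"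
  shows "sum F {m \<in> M. - 3 * k \<le> m} = (\<Sum>i<3. \<Sum>t\<in>{-k..<c i}. F (3 * t + int i))"
proof -
  have "(\<Sum>i<3. \<Sum>t\<in>{-k..<c i}. F (3 * t + int i)) =
      (\<Sum>(i, t)\<in>(SIGMA i:{..<3}. {-k..<c i}). F (3 * t + int i))"
    by (rule sum.Sigma) auto
  also have "\<dots> = sum F {m \<in> M. - 3 * k \<le> m}"
    by (rule sum.reindex_bij_witness[of _ "\<lambda>m. (nat (m mod 3), m div 3)" "\<lambda>(i, t). 3 * t + int i"])
       (auto simp: on_runners_iff[OF assms])
  finally show ?thesis ..
qed

lemma sum_int_range:
  fixes a b :: int
  assumes "a \<le> b"
  shows "2 * \<Sum>{a..<b} = (b - a) * (a + b - 1)"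
  using assms
proof (induction b rule: int_ge_induct)
  case (step b)
  then have "{a..<b + 1} = insert b {a..<b}" by auto
  with step show ?case by (simp add: algebra_simps)
qed simp

lemma sum_lessThan_3: "(\<Sum>i<3. f i) = f 0 + f 1 + f (2::nat)"
  by (simp add: eval_nat_numeral)

lemma card_on_runners:
  assumes run: "on_runners M c" and k: "k \<ge> \<bar>c 0\<bar> + \<bar>c 1\<bar> + \<bar>c 2\<bar>"
  shows "finite {m \<in> M. - 3 * k \<le> m}" "int (card {m \<in> M. - 3 * k \<le> m}) = c 0 + c 1 + c 2 + 3 * k"
proof -
  have "{m \<in> M. - 3 * k \<le> m} \<subseteq> {- 3 * k..3 * k + 3}"
  proof
    fix m assume "m \<in> {m \<in> M. - 3 * k \<le> m}"
    then have *: "m div 3 < c (nat (m mod 3))" "- 3 * k \<le> m"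
      using on_runners_iff[OF run] by auto
    have "m mod 3 = 0 \<or> m mod 3 = 1 \<or> m mod 3 = 2"
      by presburger
    with * k have "m div 3 < k" by auto
    with * show "m \<in> {- 3 * k..3 * k + 3}" by auto
  qed
  then show "finite {m \<in> M. - 3 * k \<le> m}"
    by (rule finite_subset) auto
  show "int (card {m \<in> M. - 3 * k \<le> m}) = c 0 + c 1 + c 2 + 3 * k"
  proof -
    have "- k \<le> c 0" "- k \<le> c 1" "- k \<le> c 2"
      using k by auto
    then show ?thesis
      using sum_on_runners[OF run, of "\<lambda>_. 1::int" k] by (simp add: sum_lessThan_3 del: One_nat_def)
  qed
qed

text \<open>
  The first \<open>N\<close> beads are those that are at least \<open>- N\<close>, as soon as \<open>N\<close> is at least the number of parts.
  Counting them row by row gives \<open>N\<close>, and runner by runner \<open>c 0 + c 1 + c 2 + N\<close>; summing them in the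
  two ways expresses the size by the levels.
\<close>

lemma size_on_runners:
  assumes part: "is_partition lam" and run: "on_runners (range (bead lam)) c"
  shows "c 0 + c 1 + c 2 = 0"
    and "2 * int (sum_list lam) = 3 * ((c 0)\<^sup>2 + (c 1)\<^sup>2 + (c 2)\<^sup>2) + 2 * c 1 + 4 * c 2"
proof -
  \<comment> \<open>Large enough that the first \<open>3 * k\<close> rows contain all parts and that \<open>- k\<close> lies below all three levels.\<close>
  define k where "k = int (length lam) + \<bar>c 0\<bar> + \<bar>c 1\<bar> + \<bar>c 2\<bar>"
  define N where "N = nat (3 * k)"
  have N: "int N = 3 * k" "length lam \<le> N"
    by (auto simp: N_def k_def)
  have B: "{m \<in> range (bead lam). - 3 * k \<le> m} = bead lam ` {..<N}"
  proof -
    have "- 3 * k \<le> bead lam i \<longleftrightarrow> i < N" for i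
      using N by (auto simp: bead_def part_def)
    then show ?thesis by auto
  qed
  have inj: "inj_on (bead lam) {..<N}"
    using inj_bead[OF part] by (rule inj_on_subset) auto
  show c: "c 0 + c 1 + c 2 = 0"
    using card_on_runners(2)[OF run, of k] N inj unfolding B by (simp add: card_image k_def)
  have "sum_list lam = (\<Sum>i<N. part lam i)"
  proof -
    have "sum_list lam = (\<Sum>i<length lam. part lam i)"
      by (simp add: sum_list_sum_nth part_def atLeast0LessThan)
    also have "\<dots> = (\<Sum>i<N. part lam i)"
      using N by (intro sum.mono_neutral_left) (auto simp: part_def)
    finally show ?thesis .
  qed
  moreover have "2 * (\<Sum>i<N. int i + 1) = int N * (int N + 1)"
    by (induction N) (auto simp: algebra_simps)
  ultimately have "2 * (\<Sum>i<N. bead lam i) = 2 * int (sum_list lam) - int N * (int N + 1)"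
    by (simp add: bead_def sum_subtractf sum.distrib algebra_simps)
  moreover have "(\<Sum>i<N. bead lam i) = \<Sum>{m \<in> range (bead lam). - 3 * k \<le> m}"
    unfolding B using inj by (simp add: sum.reindex)
  moreover have "2 * \<Sum>{m \<in> range (bead lam). - 3 * k \<le> m} =
      3 * (c 0 + k) * (c 0 - k - 1) + 3 * (c 1 + k) * (c 1 - k - 1) + 3 * (c 2 + k) * (c 2 - k - 1)
      + 2 * (c 1 + k) + 4 * (c 2 + k)"
  proof -
    have "2 * (\<Sum>t\<in>{-k..<c i}. 3 * t + int i) = 3 * (c i + k) * (c i - k - 1) + 2 * int i * (c i + k)"
      if "-k \<le> c i" for i
    proof -
      have "(\<Sum>t\<in>{-k..<c i}. 3 * t + int i) = 3 * \<Sum>{-k..<c i} + int i * (c i + k)"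
        using that by (simp add: sum.distrib sum_distrib_left algebra_simps)
      then show ?thesis
        using sum_int_range[OF that] by (simp add: algebra_simps)
    qed
    note this[of 0] this[of 1] this[of 2]
    moreover have "-k \<le> c 0" "-k \<le> c 1" "-k \<le> c 2"
      by (auto simp: k_def)
    ultimately show ?thesis
      unfolding sum_on_runners[OF run] by (simp add: sum_lessThan_3 del: One_nat_def)
  qed
  moreover have c0: "c 0 = - c 1 - c 2" using c by simp
  ultimately show "2 * int (sum_list lam) = 3 * ((c 0)\<^sup>2 + (c 1)\<^sup>2 + (c 2)\<^sup>2) + 2 * c 1 + 4 * c 2"
    by (simp add: N c0 power2_eq_square algebra_simps del: One_nat_def)
qed

lemma partition_with_partsE:
  fixes f :: "nat \<Rightarrow> nat"
  assumes anti: "antimono f" and zero: "f N = 0"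
  obtains lam where "is_partition lam" "\<And>i. part lam i = f i"
proof
  define L where "L = (LEAST i. f i = 0)"
  have L: "f L = 0"
    unfolding L_def using zero by (rule LeastI)
  have pos: "f i > 0 \<longleftrightarrow> i < L" for i
  proof
    show "i < L" if "f i > 0"
      using antimonoD[OF anti, of L i] L that by (cases "i < L") auto
    show "f i > 0" if "i < L"
      using not_less_Least[of i "\<lambda>i. f i = 0"] that by (simp add: L_def)
  qed
  show "is_partition (map f [0..<L])"
    using antimonoD[OF anti] pos by (auto simp: is_partition_def sorted_wrt_iff_nth_less)
  show "part (map f [0..<L]) i = f i" for i
    using pos[of i] by (auto simp: part_def)
qed

text \<open>
  Conversely, balanced levels come from a partition: list the beads in decreasing order and add
  \<open>i + 1\<close> to the \<open>i\<close>-th one. This gives weakly decreasing numbers because the beads are distinct integers, and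
  the balance makes them end in zeros instead of in another constant.
\<close>

lemma partition_with_beadsE:
  assumes run: "on_runners M c" and c: "c 0 + c 1 + c 2 = 0"
  obtains lam where "is_partition lam" "range (bead lam) = M"
proof -
  define k where "k = \<bar>c 0\<bar> + \<bar>c 1\<bar> + \<bar>c 2\<bar>"
  define N where "N = nat (3 * k)"
  have N: "int N = 3 * k" by (auto simp: N_def k_def)
  define B where "B = {m \<in> M. - 3 * k \<le> m}"
  have B: "finite B" "card B = N"
    using card_on_runners[OF run, of k] c N by (auto simp: B_def k_def)
  have below: "m \<in> M" if "m < - 3 * k" for m
  proof -
    have "m mod 3 = 0 \<or> m mod 3 = 1 \<or> m mod 3 = 2"
      by presburger
    then show ?thesis
      using that on_runners_iff[OF run, of m] by (auto simp: k_def)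
  qed
  define xs where "xs = rev (sorted_list_of_set B)"
  have xs: "set xs = B" "length xs = N" "sorted_wrt (>) xs"
    using B by (auto simp: xs_def sorted_wrt_rev strict_sorted_list_of_set)
  define b where "b i = (if i < N then xs ! i else - int i - 1)" for i
  have b_step: "b (Suc i) < b i" for i
  proof -
    have "- 3 * k \<le> xs ! i" if "i < N" for i
      using xs that nth_mem[of i xs] by (auto simp: B_def)
    then show ?thesis
      using xs N sorted_wrt_nth_less[OF xs(3), of i "Suc i"] by (force simp: b_def)
  qed
  have range_b: "range b = M"
  proof (intro equalityI subsetI)
    fix m assume "m \<in> range b"
    then obtain i where i: "m = b i" by auto
    show "m \<in> M"
    proof (cases "i < N")
      case True
      then have "xs ! i \<in> B" using xs nth_mem by blast
      then show ?thesis using True i by (simp add: b_def B_def)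
    next
      case False
      then show ?thesis using i N by (intro below) (simp add: b_def)
    qed
  next
    fix m assume m: "m \<in> M"
    show "m \<in> range b"
    proof (cases "m < - 3 * k")
      case True
      then show ?thesis
        using N by (intro image_eqI[of _ _ "nat (- m - 1)"]) (auto simp: b_def)
    next
      case False
      then have "m \<in> set xs" using m xs by (simp add: B_def)
      then obtain i where "i < N" "m = xs ! i"
        using xs by (metis in_set_conv_nth)
      then show ?thesis
        by (intro image_eqI[of _ _ i]) (auto simp: b_def)
    qed
  qed
  define f where "f i = nat (b i + int i + 1)" for i
  \<comment> \<open>Strictly decreasing integers drop by at least one at each step.\<close>
  have anti_b: "b j + int j \<le> b i + int i" if "i \<le> j" for i j
    using that
  proof (induction rule: dec_induct)
    case (step j)
    then show ?case using b_step[of j] by simp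
  qed simp
  have anti: "antimono f"
    using anti_b by (intro antimonoI) (simp add: f_def nat_mono)
  obtain lam where lam: "is_partition lam" "\<And>i. part lam i = f i"
    using anti by (rule partition_with_partsE[of _ N]) (auto simp: f_def b_def)
  have "b i + int i + 1 \<ge> 0" for i
  proof -
    have "b (max i N) + int (max i N) \<le> b i + int i"
      by (rule anti_b) simp
    then show ?thesis by (simp add: b_def[of "max i N"])
  qed
  then have "bead lam i = b i" for i
    by (simp add: bead_def lam f_def)
  then have "bead lam = b"
    by (rule ext)
  then have "range (bead lam) = M"
    using range_b by simp
  with lam(1) show ?thesis by (rule that)
qed

section \<open>Characteristic vectors of 3-cores of given size\<close>

text \<open>
  The equation is the size formula after eliminating \<open>c 0 = - c 1 - c 2\<close>. Conversely a pair \<open>(x, y)\<close>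
  prescribes balanced levels, hence a partition; its beads are closed under subtracting 3 by
  construction, and the size formula shows that it has the right size.
\<close>

lemma core_vecs_eq: "core_vecs n = {(x, y). 3 * (x\<^sup>2 + x * y + y\<^sup>2) + x + 2 * y = int n}"
proof (intro equalityI subsetI)
  fix v assume "v \<in> core_vecs n"
  then obtain lam where lam: "v = char_vec lam" "is_3core lam" "sum_list lam = n"
    by (auto simp: core_vecs_def)
  then have part: "is_partition lam"
    by (simp add: is_3core_def)
  obtain c where run: "on_runners (range (bead lam)) c"
    using lam(2) by (rule range_bead_on_runnersE)
  have "v = (c 1, c 2)"
    by (simp add: lam char_vec_def char_coeff_eq[OF part run])
  moreover have "c 0 = - c 1 - c 2"
    using size_on_runners(1)[OF part run] by simp
  ultimately show "v \<in> {(x, y). 3 * (x\<^sup>2 + x * y + y\<^sup>2) + x + 2 * y = int n}"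
    using size_on_runners(2)[OF part run] unfolding lam(3)
    by simp (simp add: power2_eq_square algebra_simps)
next
  fix v assume "v \<in> {(x, y). 3 * (x\<^sup>2 + x * y + y\<^sup>2) + x + 2 * y = int n}"
  then obtain x y where v: "v = (x, y)" "3 * (x\<^sup>2 + x * y + y\<^sup>2) + x + 2 * y = int n"
    by auto
  define c where "c i = [- x - y, x, y] ! i" for i
  have c: "c 0 = - x - y" "c 1 = x" "c 2 = y"
    by (auto simp: c_def)
  define M where "M = {m. m div 3 < c (nat (m mod 3))}"
  have run: "on_runners M c"
    by (simp add: on_runners_def M_def)
  obtain lam where lam: "is_partition lam" "range (bead lam) = M"
    using run by (rule partition_with_beadsE) (simp add: c del: One_nat_def)
  note run = run[folded lam(2)]
  have "m - 3 \<in> M" if "m \<in> M" for m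
  proof -
    have "(m - 3) div 3 = m div 3 - 1" "(m - 3) mod 3 = m mod 3"
      by presburger+
    with that show ?thesis by (simp add: M_def)
  qed
  then have "is_3core lam"
    using is_3core_iff[OF lam(1)] lam(2) by blast
  moreover have "char_vec lam = v"
    by (simp add: char_vec_def char_coeff_eq[OF lam(1) run] c v del: One_nat_def)
  moreover have "sum_list lam = n"
    using size_on_runners(2)[OF lam(1) run] v by (simp add: power2_eq_square algebra_simps c del: One_nat_def)
  ultimately show "v \<in> core_vecs n"
    by (auto simp: core_vecs_def)
qed

text \<open>
  The map \<^const>\<open>theta\<close> completes the square in the formula for the size. A solution \<open>(u, v)\<close> has \<open>u \<equiv> v\<close>
  modulo 2, so the two congruences modulo 3 are enough to make \<open>(u - v) / 6\<close> an integer.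
\<close>

lemma theta_image_core_vecs:
  "theta ` core_vecs n = {(u, v). u\<^sup>2 + 3 * v\<^sup>2 = 12 * int n + 4 \<and> u mod 3 = 1 \<and> v mod 3 = 1}"
proof (intro equalityI subsetI)
  fix w assume "w \<in> theta ` core_vecs n"
  then obtain x y where w: "w = (6 * x + 3 * y + 1, 3 * y + 1)"
      "3 * (x\<^sup>2 + x * y + y\<^sup>2) + x + 2 * y = int n"
    by (auto simp: core_vecs_eq theta_def)
  have "(6 * x + 3 * y + 1) mod 3 = 1" "(3 * y + 1) mod 3 = 1"
    by presburger+
  then show "w \<in> {(u, v). u\<^sup>2 + 3 * v\<^sup>2 = 12 * int n + 4 \<and> u mod 3 = 1 \<and> v mod 3 = 1}"
    by (simp add: w(1) flip: w(2)) (simp add: power2_eq_square algebra_simps)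
next
  fix w assume "w \<in> {(u, v). u\<^sup>2 + 3 * v\<^sup>2 = 12 * int n + 4 \<and> u mod 3 = 1 \<and> v mod 3 = 1}"
  then obtain u v where w: "w = (u, v)" "u\<^sup>2 + 3 * v\<^sup>2 = 12 * int n + 4" "u mod 3 = 1" "v mod 3 = 1"
    by auto
  have "even (u\<^sup>2 + 3 * v\<^sup>2)"
    unfolding w by simp
  then have "even u \<longleftrightarrow> even v"
    by simp
  define x y where "x = (u - v) div 6" and "y = v div 3"
  have "v = 3 * y + 1"
    using w(4) unfolding y_def by presburger
  moreover have "6 dvd u - v"
    using w(3,4) \<open>even u \<longleftrightarrow> even v\<close> by presburger
  then have "u = 6 * x + v"
    unfolding x_def by simp
  ultimately have uv: "v = 3 * y + 1" "u = 6 * x + 3 * y + 1"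
    by simp_all
  have "12 * (3 * (x\<^sup>2 + x * y + y\<^sup>2) + x + 2 * y) = 12 * int n"
    using w(2) unfolding uv by (simp add: power2_eq_square algebra_simps)
  then show "w \<in> theta ` core_vecs n"
    unfolding w uv by (intro image_eqI[of _ _ "(x, y)"]) (auto simp: core_vecs_eq theta_def)
qed

section \<open>Arithmetic of the Eisenstein integers\<close>

lemma eis_j_eq: "eis_j = - (1 / 2) + (sqrt 3 / 2) * \<i>"
proof -
  have "2 * pi / 3 = pi - pi / 3" by simp
  then have "cos (2 * pi / 3) = - (1 / 2)" "sin (2 * pi / 3) = sqrt 3 / 2"
    by (simp_all only: cos_pi_minus sin_pi_minus cos_60 sin_60)
  moreover have "eis_j = cis (2 * pi / 3)"
    unfolding eis_j_def cis_conv_exp by (rule arg_cong[of _ _ exp]) simp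
  ultimately show ?thesis
    by (auto simp: complex_eq_iff)
qed

lemma eis_j_sq: "eis_j * eis_j = - 1 - eis_j"
  by (simp add: eis_j_eq complex_eq_iff)

lemma cnj_eis_j: "cnj eis_j = - 1 - eis_j"
  by (simp add: eis_j_eq complex_eq_iff)

definition eis :: "int \<Rightarrow> int \<Rightarrow> complex" where
  "eis a b = of_int a + of_int b * eis_j"

lemma in_eisenstein_iff: "z \<in> carrier eisenstein \<longleftrightarrow> (\<exists>a b. z = eis a b)"
  by (simp add: eisenstein_def eis_def)

lemma eis_in_eisenstein [simp]: "eis a b \<in> carrier eisenstein"
  by (auto simp: in_eisenstein_iff)

lemma eis_eq_iff: "eis a b = eis c d \<longleftrightarrow> a = c \<and> b = d"
  by (auto simp: eis_def eis_j_eq complex_eq_iff)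

lemma eis_coords: "eis a b = (of_int (2 * a - b) + of_int b * \<i> * of_real (sqrt 3)) / 2"
  by (simp add: eis_def eis_j_eq complex_eq_iff field_simps)

lemma eis_mult: "eis a b * eis c d = eis (a * c - b * d) (a * d + b * c - b * d)"
proof -
  have "eis a b * eis c d = of_int (a * c) + of_int (a * d + b * c) * eis_j + of_int (b * d) * (eis_j * eis_j)"
    by (simp add: eis_def algebra_simps)
  then show ?thesis
    unfolding eis_j_sq by (simp add: eis_def algebra_simps)
qed

lemma cnj_eis: "cnj (eis a b) = eis (a - b) (- b)"
  by (simp add: eis_def cnj_eis_j algebra_simps)

lemma of_int_eis: "of_int a = eis a 0"
  by (simp add: eis_def)

lemma eis_norm_eis: "eis_norm (eis a b) = of_int (a\<^sup>2 - a * b + b\<^sup>2)"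
  by (simp add: eis_norm_def cnj_eis eis_mult of_int_eis eis_eq_iff power2_eq_square algebra_simps del: of_int_add of_int_diff of_int_mult)

lemma eis_norm_of_int: "eis_norm (of_int a) = of_int (a\<^sup>2)"
  by (simp add: eis_norm_def power2_eq_square)

lemma eis_norm_mult: "eis_norm (z * w) = eis_norm z * eis_norm w"
  by (simp add: eis_norm_def)

lemma eis_norm_cnj [simp]: "eis_norm (cnj z) = eis_norm z"
  by (simp add: eis_norm_def mult.commute)

lemma eis_norm_power: "eis_norm (z ^ k) = eis_norm z ^ k"
  by (simp add: eis_norm_def power_mult_distrib)

lemma eis_norm_prod: "eis_norm (prod f A) = (\<Prod>a\<in>A. eis_norm (f a))"
  by (simp add: eis_norm_def prod.distrib)

lemma eisenstein_mult: "z \<in> carrier eisenstein \<Longrightarrow> w \<in> carrier eisenstein \<Longrightarrow> z * w \<in> carrier eisenstein"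
  by (auto simp: in_eisenstein_iff[of z] in_eisenstein_iff[of w] eis_mult)

lemma eisenstein_one: "1 \<in> carrier eisenstein"
  using eis_in_eisenstein[of 1 0] by (simp add: eis_def)

lemma eisenstein_of_nat: "of_nat k \<in> carrier eisenstein"
  using eis_in_eisenstein[of "int k" 0] by (simp add: eis_def)

lemma eisenstein_cnj: "z \<in> carrier eisenstein \<Longrightarrow> cnj z \<in> carrier eisenstein"
  by (auto simp: in_eisenstein_iff[of z] cnj_eis)

lemma eisenstein_power: "z \<in> carrier eisenstein \<Longrightarrow> z ^ k \<in> carrier eisenstein"
  by (induction k) (auto intro: eisenstein_mult eisenstein_one)

lemma eisenstein_prod: "(\<And>a. a \<in> A \<Longrightarrow> f a \<in> carrier eisenstein) \<Longrightarrow> prod f A \<in> carrier eisenstein"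
  by (induction A rule: infinite_finite_induct) (auto intro: eisenstein_mult eisenstein_one)

text \<open>
  The norm of an Eisenstein integer is a nonnegative integer, so the norms of a unit and of its inverse
  are both 1. Conversely an element of norm 1 has its conjugate as inverse.
\<close>

lemma eisenstein_Units_iff: "e \<in> Units eisenstein \<longleftrightarrow> e \<in> carrier eisenstein \<and> eis_norm e = 1"
proof
  assume "e \<in> Units eisenstein"
  then obtain f where ef: "e \<in> carrier eisenstein" "f \<in> carrier eisenstein" "e * f = 1"
    by (auto simp: Units_def eisenstein_def)
  then obtain a b c d where *: "e = eis a b" "f = eis c d"
    by (auto simp: in_eisenstein_iff)
  define m n where "m = a\<^sup>2 - a * b + b\<^sup>2" and "n = c\<^sup>2 - c * d + d\<^sup>2"
  have norms: "eis_norm e = of_int m" "eis_norm f = of_int n"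
    unfolding * m_def n_def by (rule eis_norm_eis)+
  have "eis_norm e * eis_norm f = 1"
    unfolding eis_norm_mult[symmetric] ef(3) by (simp add: eis_norm_def)
  then have "of_int (m * n) = (1 :: complex)"
    by (simp add: norms)
  then have "m * n = 1"
    by (simp only: of_int_eq_1_iff)
  moreover have "m \<ge> 0"
  proof -
    have "4 * m = (2 * a - b)\<^sup>2 + 3 * b\<^sup>2"
      by (simp add: m_def power2_eq_square algebra_simps)
    then show ?thesis
      using zero_le_power2[of "2 * a - b"] zero_le_power2[of b] by linarith
  qed
  ultimately have "m = 1"
    by (simp add: zmult_eq_1_iff)
  with ef norms show "e \<in> carrier eisenstein \<and> eis_norm e = 1"
    by simp
next
  assume "e \<in> carrier eisenstein \<and> eis_norm e = 1"
  then have "e \<in> carrier eisenstein" "cnj e \<in> carrier eisenstein" "e * cnj e = 1" "cnj e * e = 1"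
    by (auto simp: eisenstein_cnj eis_norm_def mult.commute)
  then show "e \<in> Units eisenstein"
    unfolding Units_def by (auto simp: eisenstein_def)
qed

lemma int_dvd_eis:
  assumes "d dvd a" "d dvd b"
  shows "\<exists>w \<in> carrier eisenstein. eis a b = of_int d * w"
proof -
  obtain a' b' where "a = d * a'" "b = d * b'"
    using assms by (auto elim!: dvdE)
  then have "eis a b = of_int d * eis a' b'"
    by (simp add: eis_def algebra_simps)
  then show ?thesis by auto
qed

section \<open>Primes in the Eisenstein integers\<close>

text \<open>
  Euclid's lemma for an element \<open>x\<close> of prime norm \<open>p\<close>, without a division algorithm. For \<open>z = a + b j\<close> and
  \<open>x = c + d j\<close>, the \<open>j\<close>-coordinates of \<open>z * cnj x\<close> and \<open>z * x\<close> have the product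
  \<open>b\<^sup>2 * N x - d\<^sup>2 * N z\<close>, a multiple of \<open>p\<close>. So \<open>p\<close> divides one of these coordinates; as \<open>p\<close> also divides the
  norm of the corresponding product, it divides the other coordinate, and \<open>p = x * cnj x\<close> can be
  cancelled.
\<close>

lemma norm_prime_dvd:
  assumes p: "prime p" and x: "x \<in> carrier eisenstein" "eis_norm x = of_nat p"
    and z: "z \<in> carrier eisenstein" "eis_norm z = of_nat m" "p dvd m"
  shows "\<exists>w \<in> carrier eisenstein. z = x * w \<or> z = cnj x * w"
proof -
  have p': "prime (int p)" using p by simp
  obtain a b where ab: "z = eis a b" using z by (auto simp: in_eisenstein_iff)
  obtain c d where cd: "x = eis c d" using x by (auto simp: in_eisenstein_iff)
  have "(of_int (a\<^sup>2 - a * b + b\<^sup>2) :: complex) = of_int (int m)"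
    using z(2) unfolding ab eis_norm_eis by simp
  then have nz: "a\<^sup>2 - a * b + b\<^sup>2 = int m"
    by (simp only: of_int_eq_iff)
  have "(of_int (c\<^sup>2 - c * d + d\<^sup>2) :: complex) = of_int (int p)"
    using x(2) unfolding cd eis_norm_eis by simp
  then have nx: "c\<^sup>2 - c * d + d\<^sup>2 = int p"
    by (simp only: of_int_eq_iff)
  have pm: "int p dvd int m" using z(3) by simp
  have "(b * c - a * d) * (b * c + a * d - b * d) =
      b\<^sup>2 * (c\<^sup>2 - c * d + d\<^sup>2) - d\<^sup>2 * (a\<^sup>2 - a * b + b\<^sup>2)"
    by (simp add: power2_eq_square algebra_simps)
  then have "int p dvd (b * c - a * d) * (b * c + a * d - b * d)"
    unfolding nz nx using pm by (simp add: dvd_diff)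
  then consider "int p dvd b * c - a * d" | "int p dvd a * d + b * c - b * d"
    using p' by (auto simp: prime_dvd_mult_iff add.commute)
  then show ?thesis
  proof cases
    case 1
    have "(a * c - a * d + b * d)\<^sup>2 - (a * c - a * d + b * d) * (b * c - a * d) + (b * c - a * d)\<^sup>2 =
        (a\<^sup>2 - a * b + b\<^sup>2) * (c\<^sup>2 - c * d + d\<^sup>2)"
      by (simp add: power2_eq_square algebra_simps)
    then have "(a * c - a * d + b * d)\<^sup>2 =
        int m * int p + (b * c - a * d) * (a * c - a * d + b * d - (b * c - a * d))"
      unfolding nz nx by (simp add: power2_eq_square algebra_simps)
    then have "int p dvd (a * c - a * d + b * d)\<^sup>2"
      using 1 by simp
    then have "int p dvd a * c - a * d + b * d"
      using p' prime_dvd_power by blast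
    from int_dvd_eis[OF this 1] obtain w
      where w: "w \<in> carrier eisenstein" "eis (a * c - a * d + b * d) (b * c - a * d) = of_nat p * w"
      by auto
    have "z * cnj x = eis (a * c - a * d + b * d) (b * c - a * d)"
      unfolding ab cd cnj_eis eis_mult by (simp add: eis_eq_iff algebra_simps)
    then have "z * cnj x = x * w * cnj x"
      using w x by (simp add: eis_norm_def mult_ac flip: x(2))
    moreover have "cnj x \<noteq> 0"
      using x p by (auto simp: eis_norm_def)
    ultimately show ?thesis
      using w by auto
  next
    case 2
    have "(a * c - b * d)\<^sup>2 - (a * c - b * d) * (a * d + b * c - b * d) + (a * d + b * c - b * d)\<^sup>2 =
        (a\<^sup>2 - a * b + b\<^sup>2) * (c\<^sup>2 - c * d + d\<^sup>2)"
      by (simp add: power2_eq_square algebra_simps)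
    then have "(a * c - b * d)\<^sup>2 =
        int m * int p + (a * d + b * c - b * d) * (a * c - b * d - (a * d + b * c - b * d))"
      unfolding nz nx by (simp add: power2_eq_square algebra_simps)
    then have "int p dvd (a * c - b * d)\<^sup>2"
      using 2 by simp
    then have "int p dvd a * c - b * d"
      using p' prime_dvd_power by blast
    from int_dvd_eis[OF this 2] obtain w
      where w: "w \<in> carrier eisenstein" "eis (a * c - b * d) (a * d + b * c - b * d) = of_nat p * w"
      by auto
    have "z * x = eis (a * c - b * d) (a * d + b * c - b * d)"
      unfolding ab cd eis_mult ..
    then have "z * x = cnj x * w * x"
      using w x by (simp add: eis_norm_def mult_ac flip: x(2))
    moreover have "x \<noteq> 0"
      using x p by (auto simp: eis_norm_def)
    ultimately show ?thesis
      using w by auto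
  qed
qed

text \<open>
  From \<open>p dvd a\<^sup>2 - a b + b\<^sup>2\<close> follows \<open>a\<^sup>3 \<equiv> (- b)\<^sup>3\<close>. For \<open>p \<equiv> 2\<close> modulo 3 cubing is injective modulo \<open>p\<close>, because
  \<open>p - 1 = 3 k + 1\<close> and Fermat's theorem make \<open>t\<close> the inverse of \<open>(t\<^sup>3)\<^sup>k\<close> for \<open>t\<close> prime to \<open>p\<close>.
  Hence \<open>a \<equiv> - b\<close>, and the norm form becomes \<open>3 a\<^sup>2\<close>.
\<close>

lemma inert_prime_dvd:
  assumes p: "p \<in> primes2" and dvd: "int p dvd a\<^sup>2 - a * b + b\<^sup>2"
  shows "int p dvd a" "int p dvd b"
proof -
  have pr: "prime p" "prime (int p)" and mod: "p mod 3 = 2"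
    using p by (auto simp: primes2_def)
  define k where "k = p div 3"
  have k: "p - 1 = 3 * k + 1"
    using mod pr prime_gt_1_nat[of p] unfolding k_def by presburger
  have fermat: "[t * (t ^ 3) ^ k = 1] (mod int p)" if "\<not> int p dvd t" for t
  proof -
    define s where "s = nat (t mod int p)"
    have s: "int s = t mod int p"
      using pr prime_gt_0_nat by (simp add: s_def)
    then have "\<not> p dvd s"
      using that by (metis dvd_mod_iff dvd_refl int_dvd_int_iff)
    with pr have "[s ^ (p - 1) = 1] (mod p)"
      by (intro fermat_theorem)
    then have "[int s ^ (p - 1) = 1] (mod int p)"
      by (metis cong_int_iff of_nat_1 of_nat_power)
    moreover have "[int s ^ (p - 1) = t ^ (p - 1)] (mod int p)"
      unfolding s by (intro cong_pow) (simp add: cong_def)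
    ultimately have "[t ^ (p - 1) = 1] (mod int p)"
      by (metis cong_sym cong_trans)
    then show ?thesis
      unfolding k by (simp add: power_mult)
  qed
  have sum: "int p dvd a ^ 3 + b ^ 3"
  proof -
    have "a ^ 3 + b ^ 3 = (a + b) * (a\<^sup>2 - a * b + b\<^sup>2)"
      by (simp add: power2_eq_square power3_eq_cube algebra_simps)
    then show ?thesis using dvd by simp
  qed
  have iff: "int p dvd a \<longleftrightarrow> int p dvd b"
  proof
    assume "int p dvd a"
    then have "int p dvd a ^ 3" by (simp add: dvd_power_same dvd_trans power3_eq_cube)
    then have "int p dvd b ^ 3" using sum by (simp add: dvd_add_right_iff)
    then show "int p dvd b" using pr prime_dvd_power by blast
  next
    assume "int p dvd b"
    then have "int p dvd b ^ 3" by (simp add: dvd_power_same dvd_trans power3_eq_cube)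
    then have "int p dvd a ^ 3" using sum by (simp add: dvd_add_left_iff)
    then show "int p dvd a" using pr prime_dvd_power by blast
  qed
  have "int p dvd a"
  proof (rule ccontr)
    assume na: "\<not> int p dvd a"
    then have nb: "\<not> int p dvd - b" using iff by simp
    have "[a ^ 3 = (- b) ^ 3] (mod int p)"
      using sum by (simp add: cong_iff_dvd_diff)
    then have "[(a ^ 3) ^ k = ((- b) ^ 3) ^ k] (mod int p)"
      by (rule cong_pow)
    then have "[- b * (a ^ 3) ^ k = - b * ((- b) ^ 3) ^ k] (mod int p)"
      by (rule cong_scalar_left)
    then have "[- b * (a ^ 3) ^ k = a * (a ^ 3) ^ k] (mod int p)"
      using fermat[OF na] fermat[OF nb] by (meson cong_sym cong_trans)
    then have "int p dvd (- b - a) * (a ^ 3) ^ k"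
      by (simp add: cong_iff_dvd_diff algebra_simps)
    moreover have "\<not> int p dvd (a ^ 3) ^ k"
      using na pr prime_dvd_power by blast
    ultimately have "int p dvd - b - a"
      using pr by (simp add: prime_dvd_mult_iff)
    then have "int p dvd (a\<^sup>2 - a * b + b\<^sup>2) - (- b - a) * (2 * a - b)"
      using dvd by (intro dvd_diff) auto
    \<comment> \<open>Modulo \<open>- b - a\<close> the form becomes \<open>3 a\<^sup>2\<close>.\<close>
    also have "(a\<^sup>2 - a * b + b\<^sup>2) - (- b - a) * (2 * a - b) = 3 * a\<^sup>2"
      by (simp add: power2_eq_square algebra_simps)
    finally have "int p dvd 3 \<or> int p dvd a"
      using pr prime_dvd_power[OF pr(2), of a 2] by (auto simp: prime_dvd_mult_iff)
    with na have "p dvd 3"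
      by (metis int_dvd_int_iff of_nat_numeral)
    then have "p \<le> 3" by (rule dvd_imp_le) simp
    with mod have "p = 2" by presburger
    with \<open>p dvd 3\<close> show False by simp
  qed
  with iff show "int p dvd a" "int p dvd b" by auto
qed

text \<open>
  Thue's argument: a power of a primitive root is a primitive cube root of unity \<open>r\<close> modulo \<open>p\<close>. By
  the pigeonhole principle some nonzero \<open>(a, b)\<close> with entries below \<open>sqrt p\<close> satisfies \<open>a \<equiv> r b\<close>, so
  \<open>a\<^sup>2 + a b + b\<^sup>2\<close> is a multiple of \<open>p\<close> strictly between 0 and \<open>3 p\<close>. It is not \<open>2 p\<close>, since the form is
  even only if both entries are, and then it is divisible by 4.
\<close>

lemma primes1_norm:
  assumes p: "p \<in> primes1"
  shows "\<exists>x \<in> carrier eisenstein. eis_norm x = of_nat p"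
proof -
  have pr: "prime p" and mod: "p mod 3 = 1"
    using p by (auto simp: primes1_def)
  obtain r :: nat where r: "int p dvd int r * int r + int r + 1"
  proof -
    obtain g where g: "residue_primroot p g"
      using prime_primitive_root_exists[of p] prime_gt_1_nat[of p] pr by blast
    define k where "k = (p - 1) div 3"
    have k: "p - 1 = 3 * k" "k > 0"
      using mod prime_gt_1_nat[OF pr] unfolding k_def by presburger+
    have ord: "ord p g = 3 * k"
      using g pr k by (simp add: residue_primroot_def totient_prime)
    define r where "r = g ^ k"
    have "[r ^ 3 = 1] (mod p)"
      unfolding r_def by (simp add: ord_divides' ord flip: power_mult)
    then have "int p dvd int r ^ 3 - 1"
      by (metis cong_iff_dvd_diff cong_int_iff of_nat_1 of_nat_power)
    also have "int r ^ 3 - 1 = (int r - 1) * (int r * int r + int r + 1)"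
      by (simp add: power3_eq_cube algebra_simps)
    finally have "int p dvd int r - 1 \<or> int p dvd int r * int r + int r + 1"
      using pr by (simp add: prime_dvd_mult_iff)
    moreover have "\<not> [r = 1] (mod p)"
      unfolding r_def using k by (auto simp: ord_divides' ord dest: dvd_imp_le)
    then have "\<not> int p dvd int r - 1"
      by (metis cong_iff_dvd_diff cong_int_iff of_nat_1)
    ultimately show ?thesis using that by blast
  qed
  define q where "q = nat \<lfloor>sqrt p\<rfloor>"
  have q1: "q * q \<le> p"
  proof -
    have "real q \<le> sqrt p" by (simp add: q_def)
    then have "real q * real q \<le> sqrt p * sqrt p" by (intro mult_mono) auto
    then show ?thesis by (simp flip: of_nat_mult)
  qed
  have q2: "p < (q + 1) * (q + 1)"
  proof -
    have "sqrt p < real q + 1" by (simp add: q_def)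
    then have "sqrt p * sqrt p < (real q + 1) * (real q + 1)" by (intro mult_strict_mono) auto
    then have "real p < real ((q + 1) * (q + 1))" by (simp add: algebra_simps)
    then show ?thesis by (simp only: of_nat_less_iff)
  qed
  define f where "f = (\<lambda>(a, b). (int a - int r * int b) mod int p)"
  have "\<not> inj_on f ({..q} \<times> {..q})"
  proof
    assume "inj_on f ({..q} \<times> {..q})"
    moreover have "f ` ({..q} \<times> {..q}) \<subseteq> {0..<int p}"
      using prime_gt_0_nat[OF pr] by (auto simp: f_def)
    ultimately have "card ({..q} \<times> {..q}) \<le> card {0..<int p}"
      by (intro card_inj_on_le) auto
    with q2 show False by (simp add: card_cartesian_product)
  qed
  then obtain a1 b1 a2 b2 where ab: "a1 \<le> q" "b1 \<le> q" "a2 \<le> q" "b2 \<le> q"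
      "(a1, b1) \<noteq> (a2, b2)" "f (a1, b1) = f (a2, b2)"
    by (force simp: inj_on_def)
  define a b where "a = int a1 - int a2" and "b = int b1 - int b2"
  have "int p dvd (int a1 - int r * int b1) - (int a2 - int r * int b2)"
    using ab(6) by (simp add: f_def mod_eq_dvd_iff)
  then have d: "int p dvd a - int r * b"
    by (simp add: a_def b_def algebra_simps)
  have "a * a + a * b + b * b = (a - int r * b) * (a + b + int r * b) + b * b * (int r * int r + int r + 1)"
    by (simp add: algebra_simps)
  then have "int p dvd a * a + a * b + b * b"
    using d r by (metis dvd_add dvd_mult dvd_mult2)
  then obtain t where t: "a * a + a * b + b * b = int p * t"
    by (rule dvdE)
  have nz: "a \<noteq> 0 \<or> b \<noteq> 0"
    using ab(5) by (auto simp: a_def b_def)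
  have sq: "x * x < int p" if "\<bar>x\<bar> \<le> int q" for x
  proof -
    have "\<bar>x\<bar> * \<bar>x\<bar> \<le> int q * int q" using that by (intro mult_mono) auto
    also have "\<dots> \<le> int p" using q1 by (simp flip: of_nat_mult)
    finally have "x * x \<le> int p" by simp
    moreover have "x * x \<noteq> int p"
    proof
      assume "x * x = int p"
      then have "p = nat \<bar>x\<bar> * nat \<bar>x\<bar>"
        by (metis abs_mult abs_mult_self_eq abs_of_nat nat_abs_mult_distrib nat_int)
      with pr show False
        by (metis mult.right_neutral nat_dvd_1_iff_1 dvd_triv_left mult_eq_self_implies_10 not_prime_0 not_prime_1 prime_nat_iff)
    qed
    ultimately show ?thesis by simp
  qed
  have sqa: "a * a < int p" "b * b < int p"
    using ab(1-4) by (auto intro!: sq simp: a_def b_def)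
  have "0 \<le> (a - b) * (a - b)" "0 \<le> (a + b) * (a + b)" by simp_all
  then have ub: "2 * (a * b) \<le> a * a + b * b" "- (2 * (a * b)) \<le> a * a + b * b"
    by (simp_all add: algebra_simps)
  have "0 < a * a + b * b"
    using nz by (metis sum_squares_gt_zero_iff)
  then have "0 < int p * t" "int p * t < int p * 3"
    using ub sqa unfolding t[symmetric] by linarith+
  then have "0 < t" "t < 3"
    using prime_gt_0_nat[OF pr] by (simp_all add: zero_less_mult_iff)
  moreover have "t \<noteq> 2"
  proof
    assume "t = 2"
    then have "even (a * a + a * b + b * b)" using t by simp
    then have "even a" "even b" by auto
    then obtain a' b' where "a = 2 * a'" "b = 2 * b'" by (auto elim!: evenE)
    then have "int p = 2 * (a' * a' + a' * b' + b' * b')"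
      using t \<open>t = 2\<close> by (simp add: algebra_simps)
    then have "even p" by (metis dvd_triv_left even_of_nat_iff)
    then have "p = 2" using pr primes_dvd_imp_eq two_is_prime_nat by blast
    with mod show False by simp
  qed
  ultimately have "t = 1" by simp
  then have "a\<^sup>2 - a * (- b) + (- b)\<^sup>2 = int p"
    using t by (simp add: power2_eq_square)
  then have "eis_norm (eis a (- b)) = of_nat p"
    unfolding eis_norm_eis by (metis of_int_of_nat_eq)
  then show ?thesis by (intro bexI[of _ "eis a (- b)"]) auto
qed

section \<open>Factorization of Eisenstein integers of given norm\<close>

text \<open>
  Each application of Euclid's lemma strips one factor \<open>x\<close> or \<open>cnj x\<close> from \<open>z\<close> and one \<open>p\<close> from its norm.
\<close>

lemma split_prime_power:
  assumes p: "prime p" and x: "x \<in> carrier eisenstein" "eis_norm x = of_nat p"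
  shows "z \<in> carrier eisenstein \<Longrightarrow> eis_norm z = of_nat (p ^ k * m) \<Longrightarrow>
    \<exists>i w. i \<le> k \<and> w \<in> carrier eisenstein \<and> eis_norm w = of_nat m \<and> z = x ^ i * cnj x ^ (k - i) * w"
proof (induction k arbitrary: z)
  case 0
  then show ?case
    by (intro exI[of _ 0] exI[of _ z]) simp
next
  case (Suc k)
  obtain w' where w': "w' \<in> carrier eisenstein" "z = x * w' \<or> z = cnj x * w'"
    using norm_prime_dvd[OF p x Suc.prems] by auto
  have "of_nat p * eis_norm w' = eis_norm z"
    using w'(2) x(2) by (auto simp: eis_norm_mult)
  also have "\<dots> = of_nat p * of_nat (p ^ k * m)"
    by (simp add: Suc.prems(2))
  finally have "of_nat p * eis_norm w' = of_nat p * of_nat (p ^ k * m)" .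
  moreover have "(of_nat p :: complex) \<noteq> 0"
    using p by auto
  ultimately have "eis_norm w' = of_nat (p ^ k * m)"
    by (metis mult_left_cancel)
  from Suc.IH[OF w'(1) this] obtain i w where iw: "i \<le> k" "w \<in> carrier eisenstein"
      "eis_norm w = of_nat m" "w' = x ^ i * cnj x ^ (k - i) * w"
    by auto
  from w'(2) show ?case
  proof
    assume "z = x * w'"
    then show ?thesis
      using iw by (intro exI[of _ "Suc i"] exI[of _ w]) simp
  next
    assume "z = cnj x * w'"
    then show ?thesis
      using iw by (intro exI[of _ i] exI[of _ w]) (simp add: Suc_diff_le)
  qed
qed

lemma eis_norm_eq_of_natE:
  assumes "z \<in> carrier eisenstein" "eis_norm z = of_nat m"
  obtains a b where "z = eis a b" "a\<^sup>2 - a * b + b\<^sup>2 = int m"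
proof -
  obtain a b where z: "z = eis a b"
    using assms(1) by (auto simp: in_eisenstein_iff)
  then have "(of_int (a\<^sup>2 - a * b + b\<^sup>2) :: complex) = of_int (int m)"
    using assms(2) unfolding z eis_norm_eis by simp
  then have "a\<^sup>2 - a * b + b\<^sup>2 = int m"
    by (simp only: of_int_eq_iff)
  with z show ?thesis by (rule that)
qed

text \<open>
  Here each division of \<open>z\<close> by \<open>p\<close> takes two factors \<open>p\<close> from the norm, so that their number is even.
\<close>

lemma inert_prime_power:
  assumes p: "p \<in> primes2" and m: "\<not> p dvd m"
  shows "z \<in> carrier eisenstein \<Longrightarrow> eis_norm z = of_nat (p ^ k * m) \<Longrightarrow>
    even k \<and> (\<exists>w \<in> carrier eisenstein. eis_norm w = of_nat m \<and> z = of_nat (p ^ (k div 2)) * w)"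
proof (induction k arbitrary: z rule: less_induct)
  case (less k)
  have pr: "prime p" using p by (simp add: primes2_def)
  show ?case
  proof (cases "k = 0")
    case True
    with less.prems show ?thesis by (auto intro!: bexI[of _ z])
  next
    case False
    obtain a b where ab: "z = eis a b" "a\<^sup>2 - a * b + b\<^sup>2 = int (p ^ k * m)"
      using less.prems by (rule eis_norm_eq_of_natE)
    have dvd: "int p dvd a\<^sup>2 - a * b + b\<^sup>2"
      unfolding ab(2) using False by (simp add: dvd_mult2 dvd_power)
    have "\<exists>w \<in> carrier eisenstein. eis a b = of_int (int p) * w"
      by (rule int_dvd_eis[OF inert_prime_dvd[OF p dvd]])
    then obtain w where w: "w \<in> carrier eisenstein" "z = of_nat p * w"
      unfolding ab(1) of_int_of_nat_eq by blast
    have "eis_norm (of_nat p) = of_nat p ^ 2"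
      using eis_norm_of_int[of "int p"] by simp
    then have "eis_norm z = of_nat p ^ 2 * eis_norm w"
      by (simp only: w(2) eis_norm_mult)
    moreover obtain c d where w': "w = eis c d"
      using w by (auto simp: in_eisenstein_iff)
    ultimately have "of_int (int (p ^ k * m)) = (of_int (int p ^ 2 * (c\<^sup>2 - c * d + d\<^sup>2)) :: complex)"
      using less.prems(2) by (simp add: eis_norm_eis)
    then have eq: "int (p ^ k * m) = int p ^ 2 * (c\<^sup>2 - c * d + d\<^sup>2)"
      by (simp only: of_int_eq_iff)
    have "k \<noteq> 1"
    proof
      assume "k = 1"
      then have "int p * int m = int p * (int p * (c\<^sup>2 - c * d + d\<^sup>2))"
        using eq by (simp add: power2_eq_square mult.assoc)
      then have "int m = int p * (c\<^sup>2 - c * d + d\<^sup>2)"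
        using pr by (metis mult_left_cancel not_prime_0 of_nat_eq_0_iff)
      then have "int p dvd int m" by simp
      with m show False by simp
    qed
    with False obtain l where l: "k = l + 2"
      by (metis One_nat_def Suc_1 add_2_eq_Suc' old.nat.exhaust)
    have "int p ^ 2 * int (p ^ l * m) = int (p ^ k * m)"
      by (simp add: l power_add power2_eq_square mult_ac)
    also note eq
    finally have "int p ^ 2 * int (p ^ l * m) = int p ^ 2 * (c\<^sup>2 - c * d + d\<^sup>2)" .
    then have "int (p ^ l * m) = c\<^sup>2 - c * d + d\<^sup>2"
      using pr by (metis mult_left_cancel not_prime_0 of_nat_eq_0_iff power_not_zero)
    then have "eis_norm w = of_nat (p ^ l * m)"
      unfolding w' eis_norm_eis by (metis of_int_of_nat_eq)
    then have "even l \<and> (\<exists>w' \<in> carrier eisenstein. eis_norm w' = of_nat m \<and> w = of_nat (p ^ (l div 2)) * w')"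
      using w by (intro less.IH) (auto simp: l)
    then show ?thesis
      unfolding w(2) l by (auto simp: mult_ac)
  qed
qed

lemma primes12_prime: "p \<in> primes1 \<union> primes2 \<Longrightarrow> prime p"
  by (auto simp: primes1_def primes2_def)

lemma primes12_disjoint: "primes1 \<inter> primes2 = {}"
  by (auto simp: primes1_def primes2_def)

text \<open>
  The contribution of \<open>p\<close> to an element whose norm has exact \<open>p\<close>-power \<open>p ^ k\<close>. One formula for
  both kinds of primes allows an induction over all of them.
\<close>

definition local_factor :: "(nat \<Rightarrow> complex) \<Rightarrow> nat \<Rightarrow> nat \<Rightarrow> nat \<Rightarrow> complex" where
  "local_factor x p k i =
    (if p \<in> primes1 then x p ^ i * cnj (x p) ^ (k - i) else of_nat (p ^ (k div 2)))"

lemma eisenstein_factorization: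
  assumes x: "\<And>p. p \<in> primes1 \<Longrightarrow> x p \<in> carrier eisenstein \<and> eis_norm (x p) = of_nat p"
    and S: "finite S" "S \<subseteq> primes1 \<union> primes2"
    and z: "z \<in> carrier eisenstein" "eis_norm z = of_nat (\<Prod>p\<in>S. p ^ k p)"
  shows "\<exists>j. (\<forall>p. j p \<le> k p) \<and> (\<exists>e \<in> Units eisenstein. z = e * (\<Prod>p\<in>S. local_factor x p (k p) (j p)))"
  using S z
proof (induction S arbitrary: z rule: finite_induct)
  case empty
  then show ?case
    by (intro exI[of _ "\<lambda>_. 0"]) (auto simp: eisenstein_Units_iff)
next
  case (insert p S)
  have p: "prime p" using insert.prems(1) primes12_prime by blast
  define m where "m = (\<Prod>q\<in>S. q ^ k q)"
  have norm: "eis_norm z = of_nat (p ^ k p * m)"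
    using insert by (simp add: m_def)
  have "\<exists>i w. i \<le> k p \<and> w \<in> carrier eisenstein \<and> eis_norm w = of_nat m \<and> z = local_factor x p (k p) i * w"
  proof (cases "p \<in> primes1")
    case True
    then show ?thesis
      using split_prime_power[OF p, of "x p" z "k p" m] x[of p] insert.prems(2) norm
      by (simp add: local_factor_def)
  next
    case False
    with insert.prems have p2: "p \<in> primes2" by auto
    have "\<not> p dvd m"
    proof
      assume "p dvd m"
      then obtain q where q: "q \<in> S" "p dvd q ^ k q"
        using p insert.hyps by (auto simp: m_def prime_dvd_prod_iff)
      then have "p dvd q" "prime q"
        using p prime_dvd_power insert.prems primes12_prime by blast+
      then have "p = q" using p primes_dvd_imp_eq by blast
      with q insert.hyps show False by simp
    qed
    from inert_prime_power[OF p2 this insert.prems(2) norm] show ?thesis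
      using False by (auto simp: local_factor_def)
  qed
  then obtain i w where iw: "i \<le> k p" "w \<in> carrier eisenstein" "eis_norm w = of_nat m"
      "z = local_factor x p (k p) i * w" by blast
  obtain j e where je: "\<forall>p. j p \<le> k p" "e \<in> Units eisenstein"
      "w = e * (\<Prod>p\<in>S. local_factor x p (k p) (j p))"
    using insert.IH[of w] insert.prems iw by (auto simp: m_def)
  have "(\<Prod>q\<in>S. local_factor x q (k q) ((j(p := i)) q)) = (\<Prod>q\<in>S. local_factor x q (k q) (j q))"
    using insert.hyps by (intro prod.cong) auto
  then show ?case
    using insert.hyps iw je
    by (intro exI[of _ "j(p := i)"] conjI bexI[of _ e]) (auto simp: mult_ac)
qed

lemma prime_factors_split:
  "prime_factors (3 * n + 1) =
    {p \<in> primes1. p dvd 3 * n + 1} \<union> {p \<in> primes2. p dvd 3 * n + 1}"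
proof -
  have "p mod 3 = 1 \<or> p mod 3 = 2" if "p dvd 3 * n + 1" for p
  proof (rule ccontr)
    assume "\<not> (p mod 3 = 1 \<or> p mod 3 = 2)"
    then have "3 dvd p" by presburger
    then have "3 dvd 3 * n + 1" using that dvd_trans by blast
    then show False by presburger
  qed
  then show ?thesis
    by (auto simp: prime_factors_dvd primes1_def primes2_def)
qed

lemma y_fam_eq:
  "y_fam x n j = (\<Prod>p \<in> prime_factors (3 * n + 1). local_factor x p (multiplicity p (3 * n + 1)) (j p))"
proof -
  have fin: "finite {p \<in> primes1. p dvd 3 * n + 1}" "finite {p \<in> primes2. p dvd 3 * n + 1}"
    using finite_set_mset[of "prime_factorization (3 * n + 1)"] unfolding prime_factors_split by auto
  have "x_fam x n j = (\<Prod>p \<in> {p \<in> primes1. p dvd 3 * n + 1}.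
      local_factor x p (multiplicity p (3 * n + 1)) (j p))"
    unfolding x_fam_def by (intro prod.cong) (auto simp: local_factor_def)
  moreover have "of_nat (q_of n) = (\<Prod>p \<in> {p \<in> primes2. p dvd 3 * n + 1}.
      local_factor x p (multiplicity p (3 * n + 1)) (j p))"
    unfolding q_of_def of_nat_prod using primes12_disjoint
    by (intro prod.cong) (auto simp: local_factor_def)
  ultimately show ?thesis
    unfolding y_fam_def prime_factors_split
    by (subst prod.union_disjoint) (use fin primes12_disjoint in auto)
qed

text \<open>
  The evenness of the exponents enters here: the norm of \<open>p ^ (k div 2)\<close> is \<open>p ^ k\<close> only for even \<open>k\<close>.
\<close>

lemma y_fam_norm:
  assumes x: "\<And>p. p \<in> primes1 \<Longrightarrow> x p \<in> carrier eisenstein \<and> eis_norm (x p) = of_nat p"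
    and even: "\<forall>p \<in> primes2. even (multiplicity p (3 * n + 1))"
    and j: "j \<in> families n"
  shows "y_fam x n j \<in> carrier eisenstein" "eis_norm (y_fam x n j) = of_nat (3 * n + 1)"
proof -
  have sub: "prime_factors (3 * n + 1) \<subseteq> primes1 \<union> primes2"
    unfolding prime_factors_split by auto
  have "local_factor x p k i \<in> carrier eisenstein" for p k i
    using x by (auto simp: local_factor_def
        intro!: eisenstein_mult eisenstein_power eisenstein_cnj eisenstein_of_nat simp del: of_nat_power)
  then show "y_fam x n j \<in> carrier eisenstein"
    unfolding y_fam_eq by (intro eisenstein_prod)
  have "eis_norm (local_factor x p (multiplicity p (3 * n + 1)) (j p)) = of_nat (p ^ multiplicity p (3 * n + 1))"
    if p: "p \<in> prime_factors (3 * n + 1)" for p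
  proof (cases "p \<in> primes1")
    case True
    then have "j p \<le> multiplicity p (3 * n + 1)"
      using j by (auto simp: families_def)
    then show ?thesis
      using True x by (simp add: local_factor_def eis_norm_mult eis_norm_power flip: power_add)
  next
    case False
    then have "even (multiplicity p (3 * n + 1))"
      using p sub even by auto
    then show ?thesis
      using False eis_norm_of_int[of "int p ^ (multiplicity p (3 * n + 1) div 2)"]
      by (simp add: local_factor_def flip: power_mult)
  qed
  then have "eis_norm (y_fam x n j) = of_nat (\<Prod>p \<in> prime_factors (3 * n + 1). p ^ multiplicity p (3 * n + 1))"
    unfolding y_fam_eq eis_norm_prod of_nat_prod by (intro prod.cong) auto
  also have "(\<Prod>p \<in> prime_factors (3 * n + 1). p ^ multiplicity p (3 * n + 1)) = 3 * n + 1"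
    by (subst prod_prime_factors) auto
  finally show "eis_norm (y_fam x n j) = of_nat (3 * n + 1)" .
qed

text \<open>
  All prime divisors of \<open>3 n + 1\<close> are congruent to 1 or 2 modulo 3, so the factorization applies to all of
  them at once, and the local factors multiply to \<^const>\<open>y_fam\<close>.
\<close>

lemma eis_associate_y_fam:
  assumes x: "\<And>p. p \<in> primes1 \<Longrightarrow> x p \<in> carrier eisenstein \<and> eis_norm (x p) = of_nat p"
    and z: "z \<in> carrier eisenstein" "eis_norm z = of_nat (3 * n + 1)"
  shows "\<exists>j \<in> families n. \<exists>e \<in> Units eisenstein. z = e * y_fam x n j"
proof -
  have "(\<Prod>p \<in> prime_factors (3 * n + 1). p ^ multiplicity p (3 * n + 1)) = 3 * n + 1"
    by (subst prod_prime_factors) auto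
  with z have "eis_norm z = of_nat (\<Prod>p \<in> prime_factors (3 * n + 1). p ^ multiplicity p (3 * n + 1))"
    by simp
  moreover have "prime_factors (3 * n + 1) \<subseteq> primes1 \<union> primes2"
    unfolding prime_factors_split by auto
  ultimately have "\<exists>j. (\<forall>p. j p \<le> multiplicity p (3 * n + 1)) \<and> (\<exists>e \<in> Units eisenstein.
      z = e * (\<Prod>p \<in> prime_factors (3 * n + 1). local_factor x p (multiplicity p (3 * n + 1)) (j p)))"
    using z(1) by (intro eisenstein_factorization[OF x finite_set_mset, where k = "\<lambda>p. multiplicity p (3 * n + 1)"])
  then obtain j e where je: "\<forall>p. j p \<le> multiplicity p (3 * n + 1)" "e \<in> Units eisenstein"
      "z = e * (\<Prod>p \<in> prime_factors (3 * n + 1). local_factor x p (multiplicity p (3 * n + 1)) (j p))"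
    by blast
  \<comment> \<open>Members of \<^const>\<open>families\<close> are undefined outside \<^const>\<open>primes1\<close>.\<close>
  define j' where "j' = restrict j primes1"
  have "local_factor x p k (j' p) = local_factor x p k (j p)" for p k
    by (simp add: local_factor_def j'_def)
  then have "z = e * y_fam x n j'"
    unfolding y_fam_eq by (simp add: je(3))
  moreover have "j' \<in> families n"
    using je(1) by (auto simp: families_def j'_def)
  ultimately show ?thesis using je(2) by blast
qed

section \<open>Normalized coordinates\<close>

lemma coords_eq_eisE:
  assumes "(of_int u + of_int v * \<i> * of_real (sqrt 3)) / 2 = eis a b"
  shows "u = 2 * a - b" "v = b"
proof -
  have "Im ((of_int u + of_int v * \<i> * of_real (sqrt 3)) / 2) = Im (eis a b)"
    "Re ((of_int u + of_int v * \<i> * of_real (sqrt 3)) / 2) = Re (eis a b)"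
    by (simp_all only: assms)
  then have *: "v = b" "real_of_int u = 2 * of_int a - of_int b"
    by (auto simp: eis_coords)
  then show "v = b" "u = 2 * a - b"
    by linarith+
qed

text \<open>
  In the coordinates \<open>a + b j\<close>, the residue condition on \<open>u = 2 a - b\<close> and \<open>v = b\<close> says that \<open>a \<equiv> b \<equiv> 1\<close>
  modulo 3.
\<close>

lemma normalized_coordsE:
  assumes z: "z \<in> carrier eisenstein" and uv: "normalized_coords z u v"
  obtains e a b where "e \<in> Units eisenstein" "e * z = eis a b" "u = 2 * a - b" "v = b"
    "a mod 3 = 1" "b mod 3 = 1"
proof -
  obtain e where e: "e \<in> Units eisenstein"
      "e * z = (of_int u + of_int v * \<i> * of_real (sqrt 3)) / 2" "u mod 3 = 1" "v mod 3 = 1"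
    using uv by (auto simp: normalized_coords_def)
  then have "e * z \<in> carrier eisenstein"
    using z by (auto simp: eisenstein_Units_iff intro: eisenstein_mult)
  then obtain a b where ab: "e * z = eis a b"
    by (auto simp: in_eisenstein_iff)
  have *: "u = 2 * a - b" "v = b"
    using coords_eq_eisE[of u v a b] e(2) ab by simp_all
  have "a mod 3 = 1" "b mod 3 = 1"
    using e(3,4) unfolding * by presburger+
  with e(1) ab * show ?thesis by (rule that)
qed

lemma normalized_coordsI:
  assumes "e \<in> Units eisenstein" "e * z = eis a b" "a mod 3 = 1" "b mod 3 = 1"
  shows "normalized_coords z (2 * a - b) b"
proof -
  have "(2 * a - b) mod 3 = 1"
    using assms(3,4) by presburger
  then show ?thesis
    using assms unfolding normalized_coords_def by (auto simp: eis_coords)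
qed

text \<open>
  For norm \<open>\<equiv> 1\<close> modulo 3 the sum \<open>a + b\<close> is not divisible by 3, which leaves six residue pairs
  \<open>(a, b)\<close>. The six units permute them simply transitively, so one unit leads to the pair \<open>(1, 1)\<close>.
\<close>

lemma normalized_coords_exist:
  assumes z: "z \<in> carrier eisenstein" "eis_norm z = of_nat (3 * n + 1)"
  shows "\<exists>u v. normalized_coords z u v"
proof -
  obtain a b where ab: "z = eis a b" "a\<^sup>2 - a * b + b\<^sup>2 = int (3 * n + 1)"
    using z by (rule eis_norm_eq_of_natE)
  have "(a + b) * (a + b) = 3 * (a * b) + (a\<^sup>2 - a * b + b\<^sup>2)"
    by (simp add: power2_eq_square algebra_simps)
  also have "\<dots> = 3 * (a * b + int n) + 1"
    unfolding ab(2) by simp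
  finally have "\<not> 3 dvd (a + b) * (a + b)"
    by presburger
  then have "\<not> 3 dvd a + b"
    by auto
  then have cases: "a mod 3 = 1 \<and> b mod 3 = 1 \<or> a mod 3 = 2 \<and> b mod 3 = 2 \<or>
      a mod 3 = 1 \<and> b mod 3 = 0 \<or> a mod 3 = 2 \<and> b mod 3 = 0 \<or>
      a mod 3 = 0 \<and> b mod 3 = 1 \<or> a mod 3 = 0 \<and> b mod 3 = 2"
    by presburger
  have units: "eis c d \<in> Units eisenstein" if "c\<^sup>2 - c * d + d\<^sup>2 = 1" for c d
    using that by (simp add: eisenstein_Units_iff eis_norm_eis del: of_int_add of_int_diff of_int_mult of_int_power)
  have I: "\<exists>u v. normalized_coords z u v"
    if "c\<^sup>2 - c * d + d\<^sup>2 = 1" "(c * a - d * b) mod 3 = 1" "(c * b + d * a - d * b) mod 3 = 1" for c d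
    using normalized_coordsI[OF units[OF that(1)] _ that(2,3), of z] ab(1) by (auto simp: eis_mult)
  \<comment> \<open>The units below are \<open>1\<close>, \<open>- 1\<close>, \<open>1 + j = - j\<^sup>2\<close>, \<open>- 1 - j = j\<^sup>2\<close>, \<open>- j\<close> and \<open>j\<close>.\<close>
  from cases show ?thesis
  proof (elim disjE conjE)
    assume "a mod 3 = 1" "b mod 3 = 1"
    then show ?thesis by (intro I[of 1 0]) simp_all
  next
    assume "a mod 3 = 2" "b mod 3 = 2"
    then show ?thesis by (intro I[of "-1" 0]) (simp, simp, presburger, simp, presburger)
  next
    assume "a mod 3 = 1" "b mod 3 = 0"
    then show ?thesis by (intro I[of 1 1]) (simp, simp, presburger, simp)
  next
    assume "a mod 3 = 2" "b mod 3 = 0"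
    then show ?thesis by (intro I[of "-1" "-1"]) (simp, simp, presburger, simp, presburger)
  next
    assume "a mod 3 = 0" "b mod 3 = 1"
    then show ?thesis by (intro I[of 0 "-1"]) (simp, simp, simp, presburger)
  next
    assume "a mod 3 = 0" "b mod 3 = 2"
    then show ?thesis by (intro I[of 0 1]) (simp, simp, presburger, simp, presburger)
  qed
qed

text \<open>
  Two normalized associates differ by a unit \<open>c + d j\<close>. Comparing coordinates modulo 3, where both
  elements are \<open>1 + j\<close>, gives \<open>c \<equiv> 1\<close> and \<open>d \<equiv> 0\<close>. The only unit with these residues is 1.
\<close>

lemma normalized_coords_unique:
  assumes z: "z \<in> carrier eisenstein"
    and uv: "normalized_coords z u v" "normalized_coords z u' v'"
  shows "u = u'" "v = v'"
proof -
  obtain e a b where e: "e \<in> Units eisenstein" "e * z = eis a b" "u = 2 * a - b" "v = b"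
      "a mod 3 = 1" "b mod 3 = 1"
    using z uv(1) by (rule normalized_coordsE)
  obtain e' a' b' where e': "e' \<in> Units eisenstein" "e' * z = eis a' b'" "u' = 2 * a' - b'" "v' = b'"
      "a' mod 3 = 1" "b' mod 3 = 1"
    using z uv(2) by (rule normalized_coordsE)
  define f where "f = e' * cnj e"
  have f: "f \<in> carrier eisenstein" "eis_norm f = of_nat 1"
    using e(1) e'(1) by (auto simp: f_def eisenstein_Units_iff eis_norm_mult intro: eisenstein_mult eisenstein_cnj)
  obtain c d where cd: "f = eis c d" "c\<^sup>2 - c * d + d\<^sup>2 = int 1"
    using f by (rule eis_norm_eq_of_natE)
  have "f * (e * z) = (e * cnj e) * (e' * z)"
    by (simp add: f_def mult_ac)
  also have "e * cnj e = 1"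
    using e(1) by (simp add: eisenstein_Units_iff eis_norm_def)
  finally have "eis c d * eis a b = eis a' b'"
    by (simp add: e e' cd)
  then have ab': "a' = c * a - d * b" "b' = c * b + d * a - d * b"
    by (simp_all add: eis_mult eis_eq_iff)
  obtain s t where st: "a = 3 * s + 1" "b = 3 * t + 1"
    using e(5,6) by (metis mult_div_mod_eq)
  have "a' = 3 * (c * s - d * t) + (c - d)" "b' = 3 * (c * t + d * s - d * t) + c"
    unfolding ab' st by (simp_all add: algebra_simps)
  then have "a' mod 3 = (c - d) mod 3" "b' mod 3 = c mod 3"
    by (simp_all only: mod_mult_self4)
  then have cd_mod: "(c - d) mod 3 = 1" "c mod 3 = 1"
    using e'(5,6) by simp_all
  then have d3: "3 dvd d" by presburger
  have "(2 * c - d)\<^sup>2 + 3 * d\<^sup>2 = 4"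
    using cd(2) by (simp add: power2_eq_square algebra_simps)
  then have "3 * d\<^sup>2 \<le> 4"
    using zero_le_power2[of "2 * c - d"] by linarith
  have "d = 0"
  proof (rule ccontr)
    assume "d \<noteq> 0"
    with d3 have "3 \<le> \<bar>d\<bar>" by presburger
    then have "3 * 3 \<le> \<bar>d\<bar> * \<bar>d\<bar>" by (intro mult_mono) auto
    with \<open>3 * d\<^sup>2 \<le> 4\<close> show False by (simp add: power2_eq_square)
  qed
  with cd(2) have "c = 1 \<or> c = -1"
    by (simp add: power2_eq_1_iff)
  with cd_mod have "c = 1" by auto
  with \<open>d = 0\<close> show "u = u'" "v = v'"
    using e e' ab' by simp_all
qed

lemma four_times_norm: "(2 * a - b)\<^sup>2 + 3 * b\<^sup>2 = 4 * (a\<^sup>2 - a * b + (b :: int)\<^sup>2)"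
  by (simp add: power2_eq_square algebra_simps)

section \<open>Solutions, Eisenstein integers and 3-cores\<close>

text \<open>
  Solutions of \<open>u\<^sup>2 + 3 v\<^sup>2 = 12 n + 4\<close> and Eisenstein integers of norm \<open>3 n + 1\<close> are the same thing, by
  \<open>(u, v) \<mapsto> (u + v \<i> sqrt 3) / 2\<close>; the right-hand side is even, so \<open>u \<equiv> v\<close> modulo 2.
\<close>

lemma eis_of_solution:
  fixes u v :: int
  assumes "u\<^sup>2 + 3 * v\<^sup>2 = 12 * int n + 4"
  obtains a where "u = 2 * a - v" "eis_norm (eis a v) = of_nat (3 * n + 1)"
proof -
  have "even (u\<^sup>2 + 3 * v\<^sup>2)"
    unfolding assms by simp
  then have "even (u + v)" by simp
  then obtain a where "u + v = 2 * a" by (rule evenE)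
  then have a: "u = 2 * a - v" by simp
  then have "4 * (a\<^sup>2 - a * v + v\<^sup>2) = 4 * int (3 * n + 1)"
    using assms unfolding four_times_norm[symmetric] by simp
  then have "a\<^sup>2 - a * v + v\<^sup>2 = int (3 * n + 1)"
    by (simp only: mult_cancel_left) simp
  then have "eis_norm (eis a v) = of_nat (3 * n + 1)"
    unfolding eis_norm_eis by (metis of_int_of_nat_eq)
  with a show ?thesis by (rule that)
qed

lemma solution_of_eis:
  assumes "eis_norm (eis a b) = of_nat (3 * n + 1)"
  shows "(2 * a - b)\<^sup>2 + 3 * b\<^sup>2 = 12 * int n + 4"
proof -
  obtain a' b' where "eis a b = eis a' b'" "a'\<^sup>2 - a' * b' + b'\<^sup>2 = int (3 * n + 1)"
    using eis_in_eisenstein assms by (rule eis_norm_eq_of_natE)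
  then show ?thesis
    by (simp add: four_times_norm eis_eq_iff)
qed

lemma solutions_nonempty_iff:
  "solutions (12 * n + 4) \<noteq> {} \<longleftrightarrow> (\<forall>p \<in> primes2. even (multiplicity p (3 * n + 1)))"
proof
  assume "solutions (12 * n + 4) \<noteq> {}"
  then obtain u v where "u\<^sup>2 + 3 * v\<^sup>2 = 12 * int n + 4"
    by (auto simp: solutions_def)
  then obtain a where norm: "eis_norm (eis a v) = of_nat (3 * n + 1)"
    by (rule eis_of_solution)
  show "\<forall>p \<in> primes2. even (multiplicity p (3 * n + 1))"
  proof
    fix p assume p: "p \<in> primes2"
    then have "\<not> is_unit p"
      by (auto simp: primes2_def)
    then obtain m where m: "3 * n + 1 = p ^ multiplicity p (3 * n + 1) * m" "\<not> p dvd m"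
      using multiplicity_decompose'[of "3 * n + 1" p] by (metis add_is_0 mult.commute one_neq_zero)
    from inert_prime_power[OF p m(2) eis_in_eisenstein] norm m(1)
    show "even (multiplicity p (3 * n + 1))" by metis
  qed
next
  assume even: "\<forall>p \<in> primes2. even (multiplicity p (3 * n + 1))"
  obtain x where x: "\<And>p. p \<in> primes1 \<Longrightarrow> x p \<in> carrier eisenstein \<and> eis_norm (x p) = of_nat p"
    using primes1_norm by metis
  \<comment> \<open>Any family would do: all products \<^const>\<open>y_fam\<close> have norm \<open>3 n + 1\<close>.\<close>
  have "(\<lambda>p\<in>primes1. 0) \<in> families n"
    by (auto simp: families_def)
  from y_fam_norm[OF x even this]
  obtain a b where "eis_norm (eis a b) = of_nat (3 * n + 1)"
    by (auto simp: in_eisenstein_iff)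
  then have "(2 * a - b, b) \<in> solutions (12 * n + 4)"
    by (simp add: solutions_def solution_of_eis)
  then show "solutions (12 * n + 4) \<noteq> {}" by auto
qed

lemma inj_theta: "inj theta"
  by (rule injI) (auto simp: theta_def)

theorem theorem4p1:
  fixes n :: nat
  shows "(solutions (12 * n + 4) \<noteq> {} \<longleftrightarrow> (\<forall>p \<in> primes2. even (multiplicity p (3 * n + 1)))) \<and>
    ((\<forall>p \<in> primes2. even (multiplicity p (3 * n + 1))) \<longrightarrow>
      (\<forall>x :: nat \<Rightarrow> complex.
        (\<forall>p \<in> primes1. x p \<in> carrier eisenstein \<and> ring_irreducible\<^bsub>eisenstein\<^esub> (x p)
                        \<and> eis_norm (x p) = of_nat p) \<longrightarrow>
        (\<forall>j \<in> families n. \<exists>u v. normalized_coords (y_fam x n j) u v) \<and>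
        (\<forall>u v :: (nat \<Rightarrow> nat) \<Rightarrow> int.
          (\<forall>j \<in> families n. normalized_coords (y_fam x n j) (u j) (v j)) \<longrightarrow>
          (\<forall>j \<in> families n. (u j, v j) \<in> theta ` core_vecs n) \<and>
          core_vecs n = {inv_into (core_vecs n) theta (u j, v j) | j. j \<in> families n})))"
proof (intro conjI impI allI)
  show "solutions (12 * n + 4) \<noteq> {} \<longleftrightarrow> (\<forall>p \<in> primes2. even (multiplicity p (3 * n + 1)))"
    by (rule solutions_nonempty_iff)
next
  fix x :: "nat \<Rightarrow> complex"
  assume even: "\<forall>p \<in> primes2. even (multiplicity p (3 * n + 1))"
    and "\<forall>p \<in> primes1. x p \<in> carrier eisenstein \<and> ring_irreducible\<^bsub>eisenstein\<^esub> (x p)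
                        \<and> eis_norm (x p) = of_nat p"
  then have x: "x p \<in> carrier eisenstein \<and> eis_norm (x p) = of_nat p" if "p \<in> primes1" for p
    using that by blast
  have y: "y_fam x n j \<in> carrier eisenstein" "eis_norm (y_fam x n j) = of_nat (3 * n + 1)"
    if "j \<in> families n" for j
    using y_fam_norm[of x n j] x even that by blast+
  show "\<forall>j \<in> families n. \<exists>u v. normalized_coords (y_fam x n j) u v"
    using y normalized_coords_exist by blast
  fix u v :: "(nat \<Rightarrow> nat) \<Rightarrow> int"
  assume uv: "\<forall>j \<in> families n. normalized_coords (y_fam x n j) (u j) (v j)"
  have image: "(u j, v j) \<in> theta ` core_vecs n" if j: "j \<in> families n" for j
  proof -
    obtain e a b where e: "e \<in> Units eisenstein" "e * y_fam x n j = eis a b" "u j = 2 * a - b" "v j = b"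
      using y(1)[OF j] uv j by (metis normalized_coordsE)
    have "eis_norm (eis a b) = of_nat (3 * n + 1)"
      using e(1) y(2)[OF j] unfolding e(2)[symmetric] eis_norm_mult by (simp add: eisenstein_Units_iff)
    then have "(u j)\<^sup>2 + 3 * (v j)\<^sup>2 = 12 * int n + 4"
      unfolding e(3,4) by (rule solution_of_eis)
    then show ?thesis
      using uv j by (auto simp: theta_image_core_vecs normalized_coords_def)
  qed
  then show "\<forall>j \<in> families n. (u j, v j) \<in> theta ` core_vecs n"
    by blast
  show "core_vecs n = {inv_into (core_vecs n) theta (u j, v j) | j. j \<in> families n}"
  proof (intro equalityI subsetI)
    fix c assume c: "c \<in> core_vecs n"
    obtain u0 v0 where c0: "theta c = (u0, v0)" by fastforce
    then have "(u0, v0) \<in> theta ` core_vecs n"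
      using c by (metis imageI)
    then have sol: "u0\<^sup>2 + 3 * v0\<^sup>2 = 12 * int n + 4" "u0 mod 3 = 1" "v0 mod 3 = 1"
      by (simp_all add: theta_image_core_vecs)
    obtain a where a: "u0 = 2 * a - v0" "eis_norm (eis a v0) = of_nat (3 * n + 1)"
      using sol(1) by (rule eis_of_solution)
    obtain j e where j: "j \<in> families n" and e: "e \<in> Units eisenstein" "eis a v0 = e * y_fam x n j"
      using eis_associate_y_fam[OF x eis_in_eisenstein a(2)] by blast
    have "a mod 3 = 1"
      using sol(2,3) unfolding a(1) by presburger
    with e sol(3) have "normalized_coords (y_fam x n j) u0 v0"
      unfolding a(1) by (intro normalized_coordsI[of e]) simp_all
    then have "theta c = (u j, v j)"
      using normalized_coords_unique[OF y(1)[OF j]] uv j c0 by blast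
    then have "c = inv_into (core_vecs n) theta (u j, v j)"
      using c inj_theta by (metis inj_on_subset inv_into_f_f subset_UNIV)
    with j show "c \<in> {inv_into (core_vecs n) theta (u j, v j) | j. j \<in> families n}"
      by blast
  next
    fix c assume "c \<in> {inv_into (core_vecs n) theta (u j, v j) | j. j \<in> families n}"
    then obtain j where "j \<in> families n" "c = inv_into (core_vecs n) theta (u j, v j)"
      by blast
    then show "c \<in> core_vecs n"
      using inv_into_into[OF image] by simp
  qed
qed

end
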